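(* Let $d>1$ and $1\le p\le d$ be integers. Then the expected decrease of the direct-search iteration satisfies $$\mathbb{E}_{\mathtt{ds}}[p,d]=\frac{p}{2}\,\frac{2^p}{(\sqrt{\pi})^{p}}\,\frac{\Gamma(d/2)\,\Gamma(p/2+1/2)}{\Gamma(d/2+1/2)}\,\mathcal{I}(p),$$ where $\mathcal{I}(1):=1$ and, for $p>1$, $$\mathcal{I}(p):=\int_{R(p)}\left[\prod_{i=1}^{p-1}\sin^i(\varphi_i)\right]d\varphi_{p-1}\cdots d\varphi_1,$$ with integration region $R(p)$ consisting of all $(\varphi_1,\dots,\varphi_{p-1})\in\mathbb{R}^{p-1}$ such that $\varphi_1\in[\pi/4,\pi/2]$ and, for each $i=2,\dots,p-1$, $$\varphi_i\in\left[\arctan\left(\prod_{j=1}^{i-1}\csc\varphi_j\right),\frac{\pi}{2}\right].$$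
   Context: Let $1\le p\le d$ be integers. $\mathcal{S}^{d-1}$ is the Euclidean unit sphere in $\mathbb{R}^d$, and $\mathcal{V}_{p,d}=\{X\in\mathbb{R}^{d\times p}: X^{\mathrm T}X=I_p\}$ is the Stiefel manifold with its uniform distribution (the unique probability measure invariant under left multiplication by orthogonal $d\times d$ matrices). Let $g$ be uniformly distributed on $\mathcal{S}^{d-1}$ and let $B=[b_1\ \cdots\ b_p]$ be uniformly distributed on $\mathcal{V}_{p,d}$, with $g$ and $B$ independent. Put $f^{lin}(x)=g^{\mathrm T}x$. One direct-search iteration in the random subspace, from a current iterate $x^k\in\mathbb{R}^d$ and with step size $\delta=1$, does the following: with $f|_p(z)=f^{lin}(x^k+\sum_{i=1}^p z_ib_i)$ for $z\in\mathbb{R}^p$, and with $e_1,\dots,e_p$ the canonical basis of $\mathbb{R}^p$, let $z^*$ be a minimizer of $f|_p(u)$ over $u\in\{\pm e_i\}_{i=1}^p\cup\{0\}$, and set $x^{k+1}=x^k+\sum_{i=1}^p z_i^*b_i$. The expected decrease is $\mathbb{E}_{\mathtt{ds}}[p,d]:=\mathbb{E}[f^{lin}(x^k)-f^{lin}(x^{k+1})]$, the expectation being over $g$ and $B$. $\Gamma$ is the Gamma function and $\csc=1/\sin$. *)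

theory Defs
  imports "HOL-Probability.Probability"
begin

definition stiefel :: "(real ^ 'p ^ 'd) set" where
  "stiefel = {X. transpose X ** X = mat 1}"

text \<open>
  Uniform distributions are characterised as the Borel probability measures on the ambient
  space that are concentrated on the manifold and invariant under the orthogonal group.
\<close>

definition uniform_on_sphere :: "(real ^ 'd) measure \<Rightarrow> bool" where
  "uniform_on_sphere N \<longleftrightarrow>
     prob_space N \<and> sets N = sets borel \<and> emeasure N (sphere 0 1) = 1 \<and>
     (\<forall>Q :: real ^ 'd ^ 'd. orthogonal_matrix Q \<longrightarrow> distr N borel (\<lambda>x. Q *v x) = N)"

definition uniform_on_stiefel :: "(real ^ 'p ^ 'd) measure \<Rightarrow> bool" where
  "uniform_on_stiefel N \<longleftrightarrow>
     prob_space N \<and> sets N = sets borel \<and> emeasure N stiefel = 1 \<and>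
     (\<forall>Q :: real ^ 'd ^ 'd. orthogonal_matrix Q \<longrightarrow> distr N borel (\<lambda>X. Q ** X) = N)"

definition f_lin :: "real ^ 'd \<Rightarrow> real ^ 'd \<Rightarrow> real" where
  "f_lin g x = g \<bullet> x"

definition move :: "real ^ 'd \<Rightarrow> real ^ 'p ^ 'd \<Rightarrow> real ^ 'p \<Rightarrow> real ^ 'd" where
  "move x B z = x + (\<Sum>i\<in>UNIV. z $ i *\<^sub>R column i B)"

definition poll_set :: "(real ^ 'p) set" where
  "poll_set = (\<Union>i. {axis i 1, - axis i 1}) \<union> {0}"

text \<open>
  The step \<open>z\<close> is some minimizer; no tie-breaking rule is imposed.
\<close>

definition ds_minimizer ::
    "real ^ 'd \<Rightarrow> real ^ 'd \<Rightarrow> real ^ 'p ^ 'd \<Rightarrow> real ^ 'p \<Rightarrow> bool" where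
  "ds_minimizer g x B z \<longleftrightarrow>
     is_arg_min (\<lambda>u. f_lin g (move x B u)) (\<lambda>u. u \<in> poll_set) z"

definition csc :: "real \<Rightarrow> real" where
  "csc x = 1 / sin x"

text \<open>
  Points of \<open>\<real>\<^sup>p\<^sup>-\<^sup>1\<close> are extensional functions on \<open>{1..p-1}\<close>, so that the region lives in
  the product measure space used in \<open>ds_integral\<close>. The region is only meant for \<open>p > 1\<close>.
\<close>

definition ds_region :: "nat \<Rightarrow> (nat \<Rightarrow> real) set" where
  "ds_region p = {\<phi> \<in> {1..p-1} \<rightarrow>\<^sub>E UNIV.
     \<phi> 1 \<in> {pi/4..pi/2} \<and>
     (\<forall>i\<in>{2..p-1}. \<phi> i \<in> {arctan (\<Prod>j=1..i-1. csc (\<phi> j))..pi/2})}"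

definition ds_integral :: "nat \<Rightarrow> real" where
  "ds_integral p =
     (if p = 1 then 1
      else set_lebesgue_integral (\<Pi>\<^sub>M i\<in>{1..p-1}. lborel) (ds_region p)
             (\<lambda>\<phi>. \<Prod>i=1..p-1. sin (\<phi> i) ^ i))"

end

theory Submission
  imports Defs
begin

text \<open>
  In the poll set, the best step along \<open>\<pm> b\<^sub>i\<close> decreases the linear function \<open>g\<^sup>T x\<close> by \<open>\<bar>b\<^sub>i\<^sup>T g\<bar>\<close>, so one
  iteration decreases it by the maximum of these numbers over \<open>i\<close> (\<open>ds_minimizer_decrease\<close>). As \<open>g\<close>
  and \<open>B\<close> are independent, \<open>B\<close> may be fixed. An orthogonal matrix carries coordinate vectors to the
  columns of \<open>B\<close> (\<open>stiefel_extend_orthogonal\<close>), and the law of \<open>g\<close> is rotation invariant. Hence the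
  expected decrease is the mean, over the sphere in dimension \<open>d\<close>, of the largest modulus among \<open>p\<close>
  coordinates.

  This mean is computed with Gaussian integrals. The maximum is positively homogeneous, so its mean on
  the sphere is the quotient of the Gaussian integrals of the maximum and of the norm. To see this for
  a law that is only known to be rotation invariant, it is identified with the explicit measure
  \<open>sphere_law\<close>, which is obtained from a Gaussian; rotation invariant laws on the sphere are unique by
  Christensen's argument on measures that are uniform on balls (\<open>uniformly_distributed_measures_eq\<close>).

  The integral of the norm follows from the volume of balls (\<open>nn_integral_gaussian_norm\<close>). For the
  maximum, with \<open>A\<close> the antiderivative of \<open>exp (- s\<^sup>2/2)\<close> that vanishes at \<open>0\<close>, the layer cake formula
  gives, up to constants, the integral of \<open>s * A s ^ (p - 1) * exp (- s\<^sup>2/2)\<close> over \<open>s \<ge> 0\<close>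
  (\<open>nn_integral_gaussian_Max\<close>). Scaling the \<open>p - 1\<close> inner integrals to the unit interval and
  integrating over \<open>s\<close> leaves the integral of \<open>1 / sqrt (1 + \<bar>u\<bar>\<^sup>2) ^ (p + 1)\<close> over the unit cube of
  dimension \<open>p - 1\<close>. The substitutions \<open>u\<^sub>i = csc \<phi>\<^sub>1 \<cdots> csc \<phi>\<^sub>i\<^sub>-\<^sub>1 cot \<phi>\<^sub>i\<close> turn this into the
  angular integral of the theorem (\<open>ds_integral_eq_cube\<close>).
\<close>

section \<open>Angular coordinates\<close>

text \<open>
  The substitution \<open>u = s cot \<psi>\<close>. It has \<open>sqrt (s\<^sup>2 + u\<^sup>2) = s csc \<psi>\<close> and
  \<open>\<bar>du\<bar> = s csc\<^sup>2 \<psi> d\<psi>\<close>, and it maps the angles between \<open>arctan s\<close> and \<open>pi/2\<close> onto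
  the unit interval; this is where the lower limits of the angular region come from.
\<close>
lemma nn_integral_cot_substitution:
  fixes h :: "real \<Rightarrow> ennreal"
  assumes s: "0 < s" and h[measurable]: "h \<in> borel_measurable borel"
  shows "(\<integral>\<^sup>+\<psi>. indicator {arctan s..pi/2} \<psi> * ennreal (s * (csc \<psi>)\<^sup>2) * h (s * csc \<psi>) \<partial>lborel)
       = (\<integral>\<^sup>+u. indicator {0..1} u * h (sqrt (s\<^sup>2 + u\<^sup>2)) \<partial>lborel)"
proof -
  \<comment> \<open>The sign makes the substituted function increasing, with values from \<open>-1\<close> to \<open>0\<close>; \<open>u\<close> enters only through its square.\<close>
  let ?g = "\<lambda>\<psi>. - s * cot \<psi>" and ?g' = "\<lambda>\<psi>. s * (csc \<psi>)\<^sup>2"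
  let ?f = "\<lambda>u. h (sqrt (s\<^sup>2 + u\<^sup>2))"
  have a: "0 < arctan s" "arctan s < pi / 2"
    using s arctan_ubound by auto
  have sin: "0 < sin \<psi>" if "\<psi> \<in> {arctan s..pi/2}" for \<psi>
    using that a pi_gt_zero unfolding atLeastAtMost_iff by (intro sin_gt_zero) linarith+
  have ends: "?g (arctan s) = -1" "?g (pi/2) = 0"
    using s by (auto simp: cot_altdef tan_arctan)
  have "(\<integral>\<^sup>+u. ?f u * indicator {?g (arctan s)..?g (pi/2)} u \<partial>lborel)
      = (\<integral>\<^sup>+\<psi>. ?f (?g \<psi>) * ennreal (?g' \<psi>) * indicator {arctan s..pi/2} \<psi> \<partial>lborel)"
  proof (rule nn_integral_substitution_aux)
    fix \<psi> assume "\<psi> \<in> {arctan s..pi/2}"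
    then show "(?g has_real_derivative ?g' \<psi>) (at \<psi>)"
      unfolding cot_def csc_def using sin[of \<psi>] sin_cos_squared_add[of \<psi>]
      by (auto intro!: derivative_eq_intros simp: power2_eq_square divide_simps)
         algebra
    show "0 \<le> ?g' \<psi>" using s by simp
  next
    show "continuous_on {arctan s..pi/2} ?g'"
      unfolding csc_def using sin by (intro continuous_intros) force+
  qed (use a in auto)
  also have "\<dots> = (\<integral>\<^sup>+\<psi>. indicator {arctan s..pi/2} \<psi> * ennreal (s * (csc \<psi>)\<^sup>2) * h (s * csc \<psi>) \<partial>lborel)"
  proof (rule nn_integral_cong)
    fix \<psi>
    have "sqrt (s\<^sup>2 + (?g \<psi>)\<^sup>2) = s * csc \<psi>" if "\<psi> \<in> {arctan s..pi/2}"
    proof -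
      have "1 + (cot \<psi>)\<^sup>2 = (csc \<psi>)\<^sup>2"
        using sin[OF that] by (simp add: cot_def csc_def divide_simps)
      then have "s\<^sup>2 + (?g \<psi>)\<^sup>2 = (s * csc \<psi>)\<^sup>2"
        by algebra
      then show ?thesis using s sin[OF that] by (simp add: csc_def)
    qed
    then show "?f (?g \<psi>) * ennreal (?g' \<psi>) * indicator {arctan s..pi/2} \<psi>
        = indicator {arctan s..pi/2} \<psi> * ennreal (s * (csc \<psi>)\<^sup>2) * h (s * csc \<psi>)"
      by (auto split: split_indicator simp: mult_ac)
  qed
  finally have "(\<integral>\<^sup>+\<psi>. indicator {arctan s..pi/2} \<psi> * ennreal (s * (csc \<psi>)\<^sup>2) * h (s * csc \<psi>) \<partial>lborel)
      = (\<integral>\<^sup>+u. ?f u * indicator {-1..0} u \<partial>lborel)"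
    unfolding ends by simp
  also have "\<dots> = (\<integral>\<^sup>+u. ?f u * indicator {0..1} u \<partial>lborel)"
    by (subst nn_integral_real_affine[where c = "-1" and t = 0])
       (auto intro!: nn_integral_cong split: split_indicator)
  finally show ?thesis by (simp add: mult.commute)
qed

lemma csc_measurable[measurable]: "csc \<in> borel_measurable borel"
  unfolding csc_def by measurable

text \<open>
  This lemma and the next are stated over an arbitrary space, although they are only
  applied to spaces of functions \<open>\<phi>\<close>: the \<open>measurable\<close> method would take an argument such
  as \<open>\<lambda>\<phi>. \<phi> i\<close> apart and lose the hypotheses on \<open>s\<close> and \<open>t\<close>.
\<close>
lemma measurable_angle_weight:
  fixes s t :: "'a \<Rightarrow> real"
  assumes [measurable]: "s \<in> borel_measurable M" "t \<in> borel_measurable M"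
  shows "(\<lambda>x. indicator {arctan (s x)..pi/2} (t x) * ennreal (s x * (csc (t x))\<^sup>2)) \<in> borel_measurable M"
  unfolding indicator_def atLeastAtMost_iff by measurable

lemma sets_angle_range:
  fixes s t :: "'a \<Rightarrow> real"
  assumes [measurable]: "s \<in> borel_measurable M" "t \<in> borel_measurable M"
  shows "{x \<in> space M. t x \<in> {arctan (s x)..pi/2}} \<in> sets M"
  unfolding atLeastAtMost_iff by measurable

lemma measurable_prod_csc:
  fixes I :: "nat set"
  assumes "{1..i} \<subseteq> I"
  shows "(\<lambda>\<phi>. \<Prod>j=1..i. csc (\<phi> j)) \<in> borel_measurable (\<Pi>\<^sub>M i\<in>I. lborel)"
proof (intro borel_measurable_prod measurable_compose[OF _ csc_measurable])
  fix j assume "j \<in> {1..i}"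
  with assms have "j \<in> I" by blast
  then show "(\<lambda>\<phi>. \<phi> j) \<in> borel_measurable (\<Pi>\<^sub>M i\<in>I. lborel)"
    using measurable_component_singleton[of j I "\<lambda>_. lborel"] by simp
qed

lemma measurable_angle_weights:
  fixes I :: "nat set"
  assumes I: "{1..n} \<subseteq> I"
  shows "(\<lambda>\<phi>. \<Prod>i=1..n. indicator {arctan (\<Prod>j=1..i-1. csc (\<phi> j))..pi/2} (\<phi> i)
              * ennreal ((\<Prod>j=1..i-1. csc (\<phi> j)) * (csc (\<phi> i))\<^sup>2))
          \<in> borel_measurable (\<Pi>\<^sub>M i\<in>I. lborel)"
proof (intro borel_measurable_prod_ennreal)
  fix i assume i: "i \<in> {1..n}"
  show "(\<lambda>\<phi>. indicator {arctan (\<Prod>j=1..i-1. csc (\<phi> j))..pi/2} (\<phi> i)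
        * ennreal ((\<Prod>j=1..i-1. csc (\<phi> j)) * (csc (\<phi> i))\<^sup>2)) \<in> borel_measurable (\<Pi>\<^sub>M i\<in>I. lborel)"
  proof (intro measurable_angle_weight measurable_prod_csc)
    show "(\<lambda>\<phi>. \<phi> i) \<in> borel_measurable (\<Pi>\<^sub>M i\<in>I. lborel)"
      using measurable_component_singleton[of i I "\<lambda>_. lborel"] I i by auto
    show "{1..i-1} \<subseteq> I" using i by (intro subset_trans[OF _ I]) auto
  qed
qed

lemma sin_pos_of_angles:
  assumes "\<forall>i\<in>{1..n}. \<phi> i \<in> {arctan (\<Prod>j=1..i-1. csc (\<phi> j))..pi/2}"
    and "i \<in> {1..n::nat}"
  shows "0 < sin (\<phi> i)"
  using assms(2)
proof (induction i rule: less_induct)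
  case (less i)
  have "0 < (\<Prod>j=1..i-1. csc (\<phi> j))"
    using less by (intro prod_pos) (auto simp: csc_def)
  then have "0 < arctan (\<Prod>j=1..i-1. csc (\<phi> j))" by simp
  moreover have "arctan (\<Prod>j=1..i-1. csc (\<phi> j)) \<le> \<phi> i" "\<phi> i \<le> pi / 2"
    using less.prems assms(1) by auto
  ultimately show ?case using pi_gt_zero by (intro sin_gt_zero) linarith+
qed

text \<open>
  Iterated cotangent substitution. With \<open>s\<^sub>i = csc \<phi>\<^sub>1 \<cdots> csc \<phi>\<^sub>i\<close>, the coordinates
  \<open>u\<^sub>i = s\<^sub>i\<^sub>-\<^sub>1 cot \<phi>\<^sub>i\<close> satisfy \<open>s\<^sub>i\<^sup>2 = 1 + u\<^sub>1\<^sup>2 + \<cdots> + u\<^sub>i\<^sup>2\<close>, so that the angular region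
  becomes the unit cube. The last angle is integrated first. The inner integral is again a function
  of the product of the remaining cosecants, so the statement has to allow an arbitrary \<open>h\<close> for the
  induction to go through.
\<close>
lemma nn_integral_angles_eq_cube:
  fixes h :: "real \<Rightarrow> ennreal" and n :: nat
  assumes "h \<in> borel_measurable borel"
  shows "(\<integral>\<^sup>+\<phi>. (\<Prod>i=1..n. indicator {arctan (\<Prod>j=1..i-1. csc (\<phi> j))..pi/2} (\<phi> i)
              * ennreal ((\<Prod>j=1..i-1. csc (\<phi> j)) * (csc (\<phi> i))\<^sup>2))
            * h (\<Prod>j=1..n. csc (\<phi> j)) \<partial>(\<Pi>\<^sub>M i\<in>{1..n}. lborel))
       = (\<integral>\<^sup>+u. (\<Prod>i=1..n. indicator {0..1} (u i)) * h (sqrt (1 + (\<Sum>i=1..n. (u i)\<^sup>2)))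
            \<partial>(\<Pi>\<^sub>M i\<in>{1..n}. lborel))"
  using assms
proof (induction n arbitrary: h)
  case 0
  then show ?case by simp
next
  case (Suc n)
  note [measurable] = Suc.prems
  interpret product_sigma_finite "\<lambda>_::nat. lborel :: real measure" ..
  let ?s = "\<lambda>i \<phi>. \<Prod>j=1..i. csc (\<phi> j)"
  let ?P = "\<lambda>\<phi>. \<Prod>i=1..n. (indicator {arctan (?s (i-1) \<phi>)..pi/2} (\<phi> i)
              * ennreal (?s (i-1) \<phi> * (csc (\<phi> i))\<^sup>2) :: ennreal)"
  let ?w = "\<lambda>s \<psi>. indicator {arctan s..pi/2} \<psi> * ennreal (s * (csc \<psi>)\<^sup>2) :: ennreal"
  \<comment> \<open>The integral over the last coordinate, as a function of the product of the other cosecants.\<close>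
  define H where "H s = (\<integral>\<^sup>+v. indicator {0..1} v * h (sqrt (s\<^sup>2 + v\<^sup>2)) \<partial>lborel)" for s
  have [measurable]: "H \<in> borel_measurable borel" unfolding H_def by measurable
  have ins: "{1..Suc n} = insert (Suc n) {1..n}" by auto
  have new: "Suc n \<notin> {1..n}" by simp
  have upd: "?s i (\<phi>(Suc n := \<psi>)) = ?s i \<phi>" if "i \<le> n" for i \<phi> and \<psi> :: real
    using that by (intro prod.cong) auto
  have P_upd: "?P (\<phi>(Suc n := \<psi>)) = ?P \<phi>" for \<phi> and \<psi> :: real
  proof (rule prod.cong[OF refl])
    fix i assume "i \<in> {1..n}"
    then have i: "i - 1 \<le> n" "i \<noteq> Suc n" by auto
    have "?s (i - 1) (\<phi>(Suc n := \<psi>)) = ?s (i - 1) \<phi>" using i(1) by (rule upd)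
    moreover have "(\<phi>(Suc n := \<psi>)) i = \<phi> i" using i(2) by simp
    ultimately show "?w (?s (i - 1) (\<phi>(Suc n := \<psi>))) ((\<phi>(Suc n := \<psi>)) i) = ?w (?s (i - 1) \<phi>) (\<phi> i)"
      by (simp only:)
  qed
  \<comment> \<open>The substitution needs a positive scale, which holds wherever the weights do not vanish.\<close>
  have pos: "0 < ?s n \<phi>" if "?P \<phi> \<noteq> 0" for \<phi>
  proof -
    have in_range: "\<phi> i \<in> {arctan (?s (i-1) \<phi>)..pi/2}" if i: "i \<in> {1..n}" for i
    proof (rule ccontr)
      assume "\<phi> i \<notin> {arctan (?s (i-1) \<phi>)..pi/2}"
      then have "indicator {arctan (?s (i-1) \<phi>)..pi/2} (\<phi> i) = (0 :: ennreal)"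
        by (rule indicator_simps(2))
      then have "?w (?s (i-1) \<phi>) (\<phi> i) = 0" by (simp only: mult_zero_left)
      with i have "\<exists>i\<in>{1..n}. ?w (?s (i-1) \<phi>) (\<phi> i) = 0" ..
      then have "?P \<phi> = 0" by (rule prod_zero[OF finite_atLeastAtMost])
      with \<open>?P \<phi> \<noteq> 0\<close> show False ..
    qed
    then have range: "\<forall>i\<in>{1..n}. \<phi> i \<in> {arctan (?s (i-1) \<phi>)..pi/2}" ..
    have "0 < sin (\<phi> i)" if "i \<in> {1..n}" for i
      using range that by (rule sin_pos_of_angles)
    then show ?thesis by (intro prod_pos) (auto simp: csc_def)
  qed
  have "(\<integral>\<^sup>+\<phi>. (\<Prod>i=1..Suc n. ?w (?s (i-1) \<phi>) (\<phi> i)) * h (?s (Suc n) \<phi>) \<partial>(\<Pi>\<^sub>M i\<in>{1..Suc n}. lborel))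
      = (\<integral>\<^sup>+\<phi>. (\<integral>\<^sup>+\<psi>. ?P \<phi> * (?w (?s n \<phi>) \<psi> * h (?s n \<phi> * csc \<psi>)) \<partial>lborel) \<partial>(\<Pi>\<^sub>M i\<in>{1..n}. lborel))"
  proof (simp only: ins, subst product_nn_integral_insert, goal_cases)
    case 3
    show ?case
      using ins measurable_angle_weights[of "Suc n" "insert (Suc n) {1..n}"]
        measurable_compose[OF measurable_prod_csc[of "Suc n" "insert (Suc n) {1..n}"] Suc.prems]
      by (intro borel_measurable_times_ennreal) (simp_all only: order_refl)
  next
    case 4
    show ?case
    proof (intro nn_integral_cong)
      fix \<phi> :: "nat \<Rightarrow> real" and \<psi> :: real
      let ?\<phi> = "\<phi>(Suc n := \<psi>)"
      have "(\<Prod>i\<in>insert (Suc n) {1..n}. ?w (?s (i-1) ?\<phi>) (?\<phi> i)) = ?w (?s n ?\<phi>) \<psi> * ?P ?\<phi>"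
        unfolding prod.insert[OF finite_atLeastAtMost new] by (simp only: diff_Suc_1 fun_upd_same)
      moreover have "(\<Prod>j\<in>insert (Suc n) {1..n}. csc (?\<phi> j)) = csc \<psi> * ?s n ?\<phi>"
        unfolding prod.insert[OF finite_atLeastAtMost new] by (simp only: fun_upd_same)
      ultimately show "(\<Prod>i\<in>insert (Suc n) {1..n}. ?w (?s (i-1) ?\<phi>) (?\<phi> i))
            * h (\<Prod>j\<in>insert (Suc n) {1..n}. csc (?\<phi> j))
          = ?P \<phi> * (?w (?s n \<phi>) \<psi> * h (?s n \<phi> * csc \<psi>))"
        unfolding P_upd upd[OF order_refl] by (simp only: mult_ac)
    qed
  qed auto
  also have "\<dots> = (\<integral>\<^sup>+\<phi>. ?P \<phi> * H (?s n \<phi>) \<partial>(\<Pi>\<^sub>M i\<in>{1..n}. lborel))"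
  proof (rule nn_integral_cong)
    fix \<phi> :: "nat \<Rightarrow> real"
    show "(\<integral>\<^sup>+\<psi>. ?P \<phi> * (?w (?s n \<phi>) \<psi> * h (?s n \<phi> * csc \<psi>)) \<partial>lborel) = ?P \<phi> * H (?s n \<phi>)"
    proof (cases "?P \<phi> = 0")
      case False
      show ?thesis
        unfolding H_def nn_integral_cot_substitution[OF pos[OF False] Suc.prems, symmetric]
        by (rule nn_integral_cmult) measurable
    next
      case True
      then show ?thesis by (simp only: mult_zero_left nn_integral_const)
    qed
  qed
  also have "\<dots> = (\<integral>\<^sup>+u. (\<Prod>i=1..n. indicator {0..1} (u i)) * H (sqrt (1 + (\<Sum>i=1..n. (u i)\<^sup>2)))
            \<partial>(\<Pi>\<^sub>M i\<in>{1..n}. lborel))"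
    by (rule Suc.IH) measurable
  also have "\<dots> = (\<integral>\<^sup>+u. (\<Prod>i=1..Suc n. indicator {0..1} (u i)) * h (sqrt (1 + (\<Sum>i=1..Suc n. (u i)\<^sup>2)))
            \<partial>(\<Pi>\<^sub>M i\<in>{1..Suc n}. lborel))"
  proof (simp only: ins, subst product_nn_integral_insert, goal_cases)
    case 3 then show ?case by measurable
  next
    case 4
    show ?case
    proof (rule nn_integral_cong)
      fix u :: "nat \<Rightarrow> real"
      have *: "(\<Prod>i\<in>insert (Suc n) {1..n}. indicator {0..1} ((u(Suc n := v)) i)) =
          indicator {0..1} v * (\<Prod>i=1..n. indicator {0..1} (u i) :: ennreal)"
        "(\<Sum>i\<in>insert (Suc n) {1..n}. ((u(Suc n := v)) i)\<^sup>2) = v\<^sup>2 + (\<Sum>i=1..n. (u i)\<^sup>2)" for v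
        unfolding prod.insert[OF finite_atLeastAtMost new] sum.insert[OF finite_atLeastAtMost new]
        by (simp_all only: fun_upd_same) (auto intro!: arg_cong[where f = "(*) _"] arg_cong[where f = "(+) _"] prod.cong sum.cong)
      have "0 \<le> 1 + (\<Sum>i=1..n. (u i)\<^sup>2)" by (simp add: sum_nonneg add_nonneg_nonneg)
      then show "(\<Prod>i=1..n. indicator {0..1} (u i)) * H (sqrt (1 + (\<Sum>i=1..n. (u i)\<^sup>2)))
        = (\<integral>\<^sup>+v. (\<Prod>i\<in>insert (Suc n) {1..n}. indicator {0..1} ((u(Suc n := v)) i))
            * h (sqrt (1 + (\<Sum>i\<in>insert (Suc n) {1..n}. ((u(Suc n := v)) i)\<^sup>2))) \<partial>lborel)"
        unfolding * H_def by (subst nn_integral_cmult[symmetric]) (auto simp: mult_ac add_ac)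
    qed
  qed auto
  finally show ?case .
qed

text \<open>
  The constraint on the first angle is the general one, because the empty product is \<open>1\<close> and
  \<open>arctan 1 = pi/4\<close>.
\<close>
lemma ds_region_eq:
  assumes "1 < p"
  shows "ds_region p = {\<phi> \<in> {1..p-1} \<rightarrow>\<^sub>E UNIV.
    \<forall>i\<in>{1..p-1}. \<phi> i \<in> {arctan (\<Prod>j=1..i-1. csc (\<phi> j))..pi/2}}"
proof -
  have "{1..p-1} = insert 1 {2..p-1}" using assms by auto
  then show ?thesis unfolding ds_region_def by (auto simp: arctan_one)
qed

text \<open>
  Together with the choice \<open>h s = 1 / s\<^sup>n\<^sup>+\<^sup>2\<close>, the Jacobian weights of the cotangent substitution
  turn into the integrand of the angular integral.
\<close>
lemma prod_csc_weights:
  fixes \<phi> :: "nat \<Rightarrow> real"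
  assumes "\<And>i. i \<in> {1..n} \<Longrightarrow> sin (\<phi> i) \<noteq> 0"
  shows "(\<Prod>i=1..n. (\<Prod>j=1..i-1. csc (\<phi> j)) * (csc (\<phi> i))\<^sup>2)
       = (\<Prod>j=1..n. csc (\<phi> j)) ^ (n + 2) * (\<Prod>i=1..n. sin (\<phi> i) ^ i)"
  using assms
proof (induction n)
  case (Suc n)
  define c where "c = csc (\<phi> (Suc n))"
  have c: "sin (\<phi> (Suc n)) = 1 / c" "c \<noteq> 0" using Suc.prems[of "Suc n"] by (auto simp: c_def csc_def)
  have split: "(\<Prod>i=1..Suc n. f i) = (\<Prod>i=1..n. f i) * f (Suc n)" for f :: "nat \<Rightarrow> real"
    by simp
  define S T where "S = (\<Prod>j=1..n. csc (\<phi> j))" and "T = (\<Prod>i=1..n. sin (\<phi> i) ^ i)"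
  have IH: "(\<Prod>i=1..n. (\<Prod>j=1..i-1. csc (\<phi> j)) * (csc (\<phi> i))\<^sup>2) = S ^ (n + 2) * T"
    unfolding S_def T_def using Suc.prems by (intro Suc.IH) auto
  have "c\<^sup>2 = c ^ (Suc n + 2) * (1 / c) ^ Suc n"
    using c(2) unfolding power_add[of c] by (simp add: power_one_over)
  then have "S ^ (n + 2) * T * (S * c\<^sup>2) = (S * c) ^ (Suc n + 2) * (T * (1 / c) ^ Suc n)"
    unfolding power_mult_distrib add_Suc power_Suc[of S] by (simp only: mult_ac)
  then show ?case
    unfolding split IH c(1) diff_Suc_1 by (simp only: S_def T_def c_def)
qed simp

text \<open>
  The angular integral in Cartesian form. The equation in \<open>ennreal\<close> includes that the
  Lebesgue integral defining \<open>ds_integral\<close> converges: the integrand on the cube is at most \<open>1\<close>.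
\<close>
lemma ds_integral_eq_cube:
  assumes "1 \<le> p"
  shows "ennreal (ds_integral p)
    = (\<integral>\<^sup>+u. (\<Prod>i=1..p-1. indicator {0..1} (u i)) * ennreal (1 / sqrt (1 + (\<Sum>i=1..p-1. (u i)\<^sup>2)) ^ (p + 1))
         \<partial>(\<Pi>\<^sub>M i\<in>{1..p-1}. lborel))" (is "_ = integral\<^sup>N ?M ?u")
proof (cases "p = 1")
  case True
  show ?thesis using True by (simp add: ds_integral_def space_PiM PiM_empty)
next
  case False
  with assms have p: "1 < p" by simp
  interpret product_sigma_finite "\<lambda>_::nat. lborel :: real measure" ..
  let ?R = "\<lambda>\<phi>. \<forall>i\<in>{1..p-1}. \<phi> i \<in> {arctan (\<Prod>j=1..i-1. csc (\<phi> j))..pi/2}"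
  let ?f = "\<lambda>\<phi>. indicator (ds_region p) \<phi> *\<^sub>R (\<Prod>i=1..p-1. sin (\<phi> i) ^ i) :: real"
  have [measurable]: "ds_region p \<in> sets ?M"
  proof -
    have "ds_region p = {\<phi> \<in> space ?M. ?R \<phi>}"
      unfolding ds_region_eq[OF p] by (simp add: space_PiM)
    also have "\<dots> \<in> sets ?M"
    proof (intro sets.sets_Collect_finite_All)
      fix i assume i: "i \<in> {1..p-1}"
      show "{\<phi> \<in> space ?M. \<phi> i \<in> {arctan (\<Prod>j=1..i-1. csc (\<phi> j))..pi/2}} \<in> sets ?M"
      proof (intro sets_angle_range measurable_prod_csc)
        show "(\<lambda>\<phi>. \<phi> i) \<in> borel_measurable ?M"
          using measurable_component_singleton[of i "{1..p-1}" "\<lambda>_. lborel"] i by simp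
      qed (use i in auto)
    qed auto
    finally show ?thesis .
  qed
  have "(\<integral>\<^sup>+\<phi>. ennreal (?f \<phi>) \<partial>?M) =
      (\<integral>\<^sup>+\<phi>. (\<Prod>i=1..p-1. indicator {arctan (\<Prod>j=1..i-1. csc (\<phi> j))..pi/2} (\<phi> i)
              * ennreal ((\<Prod>j=1..i-1. csc (\<phi> j)) * (csc (\<phi> i))\<^sup>2))
            * ennreal (1 / (\<Prod>j=1..p-1. csc (\<phi> j)) ^ (p + 1)) \<partial>?M)"
  proof (rule nn_integral_cong)
    fix \<phi> assume \<phi>: "\<phi> \<in> space ?M"
    show "ennreal (?f \<phi>) = (\<Prod>i=1..p-1. indicator {arctan (\<Prod>j=1..i-1. csc (\<phi> j))..pi/2} (\<phi> i)
              * ennreal ((\<Prod>j=1..i-1. csc (\<phi> j)) * (csc (\<phi> i))\<^sup>2))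
            * ennreal (1 / (\<Prod>j=1..p-1. csc (\<phi> j)) ^ (p + 1))"
    proof (cases "?R \<phi>")
      case True
      have pos: "0 < sin (\<phi> i)" if "i \<in> {1..p-1}" for i
        using sin_pos_of_angles[OF True that] .
      have cpos: "0 < csc (\<phi> i)" if "i \<in> {1..p-1}" for i
        using pos[OF that] by (simp add: csc_def)
      have nz: "sin (\<phi> i) \<noteq> 0" if "i \<in> {1..p-1}" for i
        using pos[OF that] by simp
      have cancel: "ennreal (a * b) * ennreal (1 / a) = ennreal b" if "0 < a" for a b :: real
        using that by (subst ennreal_mult''[symmetric]) auto
      have exponent: "p - 1 + 2 = p + 1" using p by simp
      let ?S = "\<Prod>j=1..p-1. csc (\<phi> j)"
      have in_R: "\<phi> \<in> ds_region p"
        using True \<phi> unfolding ds_region_eq[OF p] space_PiM by simp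
      have S: "0 < ?S" using cpos by (intro prod_pos) auto
      have "(\<Prod>i=1..p-1. indicator {arctan (\<Prod>j=1..i-1. csc (\<phi> j))..pi/2} (\<phi> i)
              * ennreal ((\<Prod>j=1..i-1. csc (\<phi> j)) * (csc (\<phi> i))\<^sup>2))
          = (\<Prod>i=1..p-1. ennreal ((\<Prod>j=1..i-1. csc (\<phi> j)) * (csc (\<phi> i))\<^sup>2))"
        using True by (intro prod.cong refl) (simp only: indicator_simps mult_1)
      also have "\<dots> = ennreal (\<Prod>i=1..p-1. (\<Prod>j=1..i-1. csc (\<phi> j)) * (csc (\<phi> i))\<^sup>2)"
        using cpos by (intro prod_ennreal mult_nonneg_nonneg prod_nonneg) (auto intro!: less_imp_le)
      also have "(\<Prod>i=1..p-1. (\<Prod>j=1..i-1. csc (\<phi> j)) * (csc (\<phi> i))\<^sup>2)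
          = ?S ^ (p + 1) * (\<Prod>i=1..p-1. sin (\<phi> i) ^ i)"
        using prod_csc_weights[of "p - 1" \<phi>, OF nz] by (simp only: exponent)
      also have "ennreal \<dots> * ennreal (1 / ?S ^ (p + 1)) = ennreal (\<Prod>i=1..p-1. sin (\<phi> i) ^ i)"
        by (rule cancel[OF zero_less_power[OF S]])
      finally show ?thesis
        using in_R by simp
    next
      case False
      then obtain i where i: "i \<in> {1..p-1}" "\<phi> i \<notin> {arctan (\<Prod>j=1..i-1. csc (\<phi> j))..pi/2}"
        by blast
      then have "(\<Prod>i=1..p-1. indicator {arctan (\<Prod>j=1..i-1. csc (\<phi> j))..pi/2} (\<phi> i)
              * ennreal ((\<Prod>j=1..i-1. csc (\<phi> j)) * (csc (\<phi> i))\<^sup>2)) = 0"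
        by (intro prod_zero) (auto intro!: bexI[of _ i])
      moreover have "\<phi> \<notin> ds_region p" using i unfolding ds_region_eq[OF p] by blast
      ultimately show ?thesis by (simp only: indicator_simps) simp
    qed
  qed
  also have "\<dots> = integral\<^sup>N ?M ?u"
    by (rule nn_integral_angles_eq_cube) measurable
  finally have eq: "(\<integral>\<^sup>+\<phi>. ennreal (?f \<phi>) \<partial>?M) = integral\<^sup>N ?M ?u" .
  have "integral\<^sup>N ?M ?u \<le> (\<integral>\<^sup>+u. (\<Prod>i=1..p-1. indicator {0..1} (u i)) \<partial>?M)"
  proof (rule nn_integral_mono)
    fix u :: "nat \<Rightarrow> real"
    have "1 \<le> sqrt (1 + (\<Sum>i=1..p-1. (u i)\<^sup>2)) ^ (p + 1)"
      by (intro one_le_power) (simp add: sum_nonneg)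
    then have "ennreal (1 / sqrt (1 + (\<Sum>i=1..p-1. (u i)\<^sup>2)) ^ (p + 1)) \<le> 1"
      by simp
    from mult_left_mono[OF this zero_le] show "?u u \<le> (\<Prod>i=1..p-1. indicator {0..1} (u i))"
      by (simp only: mult_1_right)
  qed
  also have "\<dots> = 1"
    by (subst product_nn_integral_prod) auto
  finally have fin: "integral\<^sup>N ?M ?u < \<top>"
    using ennreal_one_less_top order_le_less_trans by blast
  have "ds_integral p = enn2real (\<integral>\<^sup>+\<phi>. ennreal (?f \<phi>) \<partial>?M)"
    unfolding ds_integral_def set_lebesgue_integral_def if_not_P[OF False]
  proof (rule integral_eq_nn_integral)
    show "AE \<phi> in ?M. 0 \<le> ?f \<phi>"
    proof (intro AE_I2)
      fix \<phi>
      have "0 \<le> (\<Prod>i=1..p-1. sin (\<phi> i) ^ i)" if "\<phi> \<in> ds_region p"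
        using that sin_pos_of_angles[of "p-1" \<phi>] unfolding ds_region_eq[OF p]
        by (intro prod_nonneg) (auto intro!: zero_le_power less_imp_le)
      then show "0 \<le> ?f \<phi>" by (simp split: split_indicator)
    qed
  qed measurable
  then show ?thesis unfolding eq using fin by simp
qed

section \<open>Gaussian integrals on the line\<close>

text \<open>
  The moment \<open>\<integral>\<^sub>0\<^sup>\<infinity> s\<^sup>k exp (- s\<^sup>2/2) ds\<close> of the unnormalised Gaussian on the half line, given by its
  closed form.
\<close>
definition half_moment :: "nat \<Rightarrow> real" where
  "half_moment k = 2 powr ((real k - 1) / 2) * Gamma ((real k + 1) / 2)"

lemma Gamma_half_nat: "Gamma (real k + 1 / 2) = sqrt pi * (fact (2 * k) / (2 ^ (2 * k) * fact k))"
proof (induction k)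
  case 0
  then show ?case by (simp add: Gamma_one_half_real)
next
  case (Suc k)
  have "real k + 1 / 2 \<notin> \<int>\<^sub>\<le>\<^sub>0"
    by (metis add_pos_nonneg add.commute less_numeral_extra(1) nonpos_Ints_nonpos of_nat_0_le_iff linorder_not_le zero_less_divide_iff zero_less_numeral)
  then have "Gamma (real (Suc k) + 1 / 2) = (real k + 1 / 2) * Gamma (real k + 1 / 2)"
    using Gamma_plus1[of "real k + 1 / 2"] by (simp add: add_ac)
  also have "\<dots> = (real k + 1 / 2) * (sqrt pi * (fact (2 * k) / (2 ^ (2 * k) * fact k)))"
    by (simp only: Suc)
  also have "\<dots> = sqrt pi * (fact (2 * Suc k) / (2 ^ (2 * Suc k) * fact (Suc k)))"
  proof -
    have f: "fact (2 * Suc k) = 2 * (real k + 1) * (2 * real k + 1) * fact (2 * k)"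
      "fact (Suc k) = (real k + 1) * fact k" "(2::real) ^ (2 * Suc k) = 4 * 2 ^ (2 * k)"
      by (simp_all add: algebra_simps)
    have cancel: "(real k + 1 / 2) * (r * (u / (v * w))) = r * (2 * y * (2 * real k + 1) * u / (4 * v * (y * w)))"
      if "v \<noteq> 0" "w \<noteq> 0" "y \<noteq> 0" for r u v w y :: real
      using that by (simp add: divide_simps)
    show ?thesis unfolding f by (rule cancel) auto
  qed
  finally show ?case .
qed

lemma nn_integral_exp_square_half_line:
  "(\<integral>\<^sup>+x. indicator {0..} x * ennreal (x ^ k * exp (- x\<^sup>2)) \<partial>lborel) = ennreal (Gamma ((real k + 1) / 2) / 2)"
proof -
  have h: "has_bochner_integral lborel (\<lambda>x::real. indicator {0..} x *\<^sub>R (exp (- x\<^sup>2) * x ^ k)) (Gamma ((real k + 1) / 2) / 2)"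
  proof (cases "even k")
    case True
    then obtain j where j: "k = 2 * j" by blast
    then have "(real k + 1) / 2 = real j + 1 / 2" by simp
    then show ?thesis
      using gaussian_moment_even_pos[of j] unfolding j by (simp only: Gamma_half_nat) (simp add: field_simps)
  next
    case False
    then obtain j where j: "k = 2 * j + 1" using oddE by blast
    then have "(real k + 1) / 2 = 1 + real j" by (simp add: field_simps)
    then show ?thesis
      using gaussian_moment_odd_pos[of j] unfolding j by (simp only: Gamma_fact)
  qed
  have "(\<integral>\<^sup>+x. indicator {0..} x * ennreal (x ^ k * exp (- x\<^sup>2)) \<partial>lborel)
      = (\<integral>\<^sup>+x. ennreal (indicator {0..} x *\<^sub>R (exp (- x\<^sup>2) * x ^ k)) \<partial>lborel)"
    by (intro nn_integral_cong) (auto split: split_indicator simp: mult.commute)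
  also have "\<dots> = ennreal (integral\<^sup>L lborel (\<lambda>x. indicator {0..} x *\<^sub>R (exp (- x\<^sup>2) * x ^ k)))"
    using h by (intro nn_integral_eq_integral) (auto simp: has_bochner_integral_iff split: split_indicator intro!: AE_I2)
  also have "integral\<^sup>L lborel (\<lambda>x. indicator {0..} x *\<^sub>R (exp (- x\<^sup>2) * x ^ k)) = Gamma ((real k + 1) / 2) / 2"
    using h by (rule has_bochner_integral_integral_eq)
  finally show ?thesis .
qed

lemma nn_integral_scaled_half_moment:
  assumes c: "0 < c"
  shows "(\<integral>\<^sup>+s. indicator {0..} s * ennreal (s ^ k * exp (- (c * s)\<^sup>2 / 2)) \<partial>lborel)
       = ennreal (half_moment k / c ^ (k + 1))"
proof -
  have "(\<integral>\<^sup>+s. indicator {0..} s * ennreal (s ^ k * exp (- (c * s)\<^sup>2 / 2)) \<partial>lborel)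
      = ennreal (sqrt 2 / c) * (\<integral>\<^sup>+x. indicator {0..} (sqrt 2 / c * x)
          * ennreal ((sqrt 2 / c * x) ^ k * exp (- (c * (sqrt 2 / c * x))\<^sup>2 / 2)) \<partial>lborel)"
    using c by (subst nn_integral_real_affine[where c = "sqrt 2 / c" and t = 0]) simp_all
  also have "(\<integral>\<^sup>+x. indicator {0..} (sqrt 2 / c * x)
          * ennreal ((sqrt 2 / c * x) ^ k * exp (- (c * (sqrt 2 / c * x))\<^sup>2 / 2)) \<partial>lborel)
      = (\<integral>\<^sup>+x. ennreal ((sqrt 2 / c) ^ k) * (indicator {0..} x * ennreal (x ^ k * exp (- x\<^sup>2))) \<partial>lborel)"
  proof (rule nn_integral_cong)
    fix x :: real
    have "- (c * (sqrt 2 / c * x))\<^sup>2 / 2 = - x\<^sup>2" using c by (simp add: power_mult_distrib)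
    moreover have "0 \<le> sqrt 2 / c * x \<longleftrightarrow> 0 \<le> x" using c by (simp add: zero_le_mult_iff zero_le_divide_iff)
    moreover have "(sqrt 2 / c * x) ^ k * e = (sqrt 2 / c) ^ k * (x ^ k * e)" for e
      by (simp only: power_mult_distrib mult.assoc)
    moreover have "ennreal ((sqrt 2 / c) ^ k * e) = ennreal ((sqrt 2 / c) ^ k) * ennreal e" for e
      using c by (intro ennreal_mult') simp
    ultimately show "indicator {0..} (sqrt 2 / c * x)
          * ennreal ((sqrt 2 / c * x) ^ k * exp (- (c * (sqrt 2 / c * x))\<^sup>2 / 2))
        = ennreal ((sqrt 2 / c) ^ k) * (indicator {0..} x * ennreal (x ^ k * exp (- x\<^sup>2)))"
      unfolding indicator_def by (simp only: atLeast_iff) simp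
  qed
  also have "\<dots> = ennreal ((sqrt 2 / c) ^ k) * ennreal (Gamma ((real k + 1) / 2) / 2)"
    by (subst nn_integral_cmult) (simp_all add: nn_integral_exp_square_half_line)
  also have "ennreal (sqrt 2 / c) * \<dots> = ennreal (sqrt 2 / c * ((sqrt 2 / c) ^ k * (Gamma ((real k + 1) / 2) / 2)))"
  proof -
    have "0 \<le> sqrt 2 / c" "0 \<le> (sqrt 2 / c) ^ k" "0 \<le> Gamma ((real k + 1) / 2) / 2"
      using c by (simp_all add: Gamma_real_nonneg)
    then show ?thesis by (simp only: ennreal_mult mult_nonneg_nonneg)
  qed
  also have "sqrt 2 / c * ((sqrt 2 / c) ^ k * (Gamma ((real k + 1) / 2) / 2)) = half_moment k / c ^ (k + 1)"
  proof -
    have "sqrt 2 * sqrt 2 ^ k / 2 = 2 powr ((real k + 1) / 2) / 2 powr 1"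
      by (simp add: powr_half_sqrt[symmetric] powr_realpow[symmetric] powr_powr powr_add[symmetric] field_simps)
    also have "\<dots> = 2 powr ((real k - 1) / 2)"
      by (simp only: powr_diff[symmetric]) (simp add: field_simps)
    finally have "sqrt 2 * sqrt 2 ^ k / 2 = 2 powr ((real k - 1) / 2)" .
    moreover have "sqrt 2 / c * ((sqrt 2 / c) ^ k * (Gamma ((real k + 1) / 2) / 2))
        = (sqrt 2 * sqrt 2 ^ k / 2) * Gamma ((real k + 1) / 2) / c ^ (k + 1)"
      by (simp add: power_divide)
    ultimately show ?thesis by (simp only: half_moment_def)
  qed
  finally show ?thesis .
qed

lemma half_moment_0: "half_moment 0 = sqrt (pi / 2)"
  by (simp add: half_moment_def Gamma_one_half_real powr_minus powr_half_sqrt real_sqrt_divide field_simps)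

lemma half_moment_pos: "0 < half_moment k"
  by (simp add: half_moment_def Gamma_real_pos)

lemma half_moment_nonneg: "0 \<le> half_moment k"
  by (rule less_imp_le[OF half_moment_pos])

lemma half_moment_Suc_Suc: "half_moment (k + 2) = (real k + 1) * half_moment k"
proof -
  have "(real k + 1) / 2 \<notin> \<int>\<^sub>\<le>\<^sub>0"
    by (auto dest: nonpos_Ints_nonpos)
  then have "Gamma ((real k + 1) / 2 + 1) = (real k + 1) / 2 * Gamma ((real k + 1) / 2)"
    by (rule Gamma_plus1)
  moreover have "(real (k + 2) + 1) / 2 = (real k + 1) / 2 + 1" by simp
  moreover have "2 powr ((real (k + 2) - 1) / 2) = 2 * 2 powr ((real k - 1) / 2)"
  proof -
    have "(real (k + 2) - 1) / 2 = 1 + (real k - 1) / 2" by (simp add: field_simps)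
    then show ?thesis by (simp only: powr_add) simp
  qed
  ultimately show ?thesis unfolding half_moment_def by (simp only:) simp
qed

lemma nn_integral_even:
  fixes f :: "real \<Rightarrow> ennreal"
  assumes [measurable]: "f \<in> borel_measurable borel" and even: "\<And>x. f (- x) = f x"
  shows "(\<integral>\<^sup>+x. f x \<partial>lborel) = 2 * (\<integral>\<^sup>+x. indicator {0..} x * f x \<partial>lborel)"
proof -
  have "(\<integral>\<^sup>+x. f x \<partial>lborel) = (\<integral>\<^sup>+x. indicator {0..} x * f x + indicator {..<0} x * f x \<partial>lborel)"
    by (intro nn_integral_cong) (auto split: split_indicator)
  also have "\<dots> = (\<integral>\<^sup>+x. indicator {0..} x * f x \<partial>lborel) + (\<integral>\<^sup>+x. indicator {..<0} x * f x \<partial>lborel)"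
    by (rule nn_integral_add) measurable
  also have "(\<integral>\<^sup>+x. indicator {..<0} x * f x \<partial>lborel) = (\<integral>\<^sup>+x. indicator {..<0} (- x) * f (- x) \<partial>lborel)"
    by (subst nn_integral_real_affine[where c = "-1" and t = 0]) simp_all
  also have "\<dots> = (\<integral>\<^sup>+x. indicator {0..} x * f x \<partial>lborel)"
    using AE_lborel_singleton[of "0::real"]
    by (intro nn_integral_cong_AE) (auto simp: even split: split_indicator elim!: eventually_mono)
  finally show ?thesis by (simp add: mult_2)
qed

lemma nn_integral_gaussian: "(\<integral>\<^sup>+x. ennreal (exp (- x\<^sup>2 / 2)) \<partial>lborel) = ennreal (sqrt (2 * pi))"
proof -
  have "(\<integral>\<^sup>+x. ennreal (exp (- x\<^sup>2 / 2)) \<partial>lborel) = 2 * ennreal (sqrt (pi / 2))"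
    using nn_integral_scaled_half_moment[of 1 0] by (subst nn_integral_even) (auto simp: half_moment_0)
  also have "\<dots> = ennreal (2 * sqrt (pi / 2))" by (simp add: ennreal_mult')
  also have "2 * sqrt (pi / 2) = sqrt (4 * (pi / 2))" by (simp only: real_sqrt_mult real_sqrt_four)
  finally show ?thesis by simp
qed

text \<open>
  The antiderivative of the Gaussian is not elementary, but only its derivative, its value at \<open>0\<close>
  and its limit are ever used. They are passed around as hypotheses on a function \<open>A\<close>.
\<close>
lemma gaussian_antiderivative:
  obtains A :: "real \<Rightarrow> real" where "A 0 = 0" "\<And>x. DERIV A x :> exp (- x\<^sup>2 / 2)"
    "(A \<longlongrightarrow> sqrt (pi / 2)) at_top"
proof -
  have "isCont (\<lambda>x::real. exp (- x\<^sup>2 / 2)) x" for x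
    by (intro continuous_intros) simp
  then obtain F where F: "\<And>x::real. (F has_vector_derivative exp (- x\<^sup>2 / 2)) (at x)"
    using einterval_antiderivative[of "-\<infinity>" "\<infinity>" "\<lambda>x. exp (- x\<^sup>2 / 2)"] by auto
  define A where "A x = F x - F 0" for x
  have deriv: "DERIV A x :> exp (- x\<^sup>2 / 2)" for x
    unfolding A_def using F[of x] by (auto intro!: derivative_eq_intros simp: has_real_derivative_iff_has_vector_derivative)
  have mono: "mono A"
    using deriv by (intro monoI DERIV_nonneg_imp_nondecreasing[of _ _ A]) (auto intro: exp_ge_zero)
  have total: "(\<integral>\<^sup>+x. ennreal (exp (- x\<^sup>2 / 2)) * indicator {0..} x \<partial>lborel) = ennreal (sqrt (pi / 2))"
    using nn_integral_scaled_half_moment[of 1 0] by (simp add: half_moment_0 mult.commute)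
  have bound: "A x \<le> sqrt (pi / 2)" if "0 \<le> x" for x
  proof -
    have "ennreal (A x - A 0) = (\<integral>\<^sup>+y. ennreal (exp (- y\<^sup>2 / 2)) * indicator {0..x} y \<partial>lborel)"
      using that deriv by (intro nn_integral_FTC_Icc[symmetric]) auto
    also have "\<dots> \<le> ennreal (sqrt (pi / 2))"
      unfolding total[symmetric] by (intro nn_integral_mono) (auto split: split_indicator)
    finally show ?thesis by (simp add: A_def)
  qed
  have "convergent (\<lambda>n. A (real n))"
    by (rule incseq_convergent[where X = "\<lambda>n. A (real n)" and B = "sqrt (pi / 2)"])
       (auto simp: incseq_def bound convergent_def intro!: monoD[OF mono])
  then obtain T where T: "(\<lambda>n. A (real n)) \<longlonglongrightarrow> T" by (auto simp: convergent_def)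
  then have lim: "(A \<longlongrightarrow> T) at_top"
    by (intro tendsto_at_topI_sequentially_real mono)
  have "ennreal (sqrt (pi / 2)) = ennreal (T - A 0)"
    unfolding total[symmetric] using deriv lim by (intro nn_integral_FTC_atLeast) auto
  moreover have "0 \<le> T"
  proof -
    have "0 \<le> A (real n)" for n using monoD[OF mono, of 0 "real n"] by (simp add: A_def)
    then show ?thesis using LIMSEQ_le_const[OF T] by blast
  qed
  ultimately have "T = sqrt (pi / 2)" by (simp add: A_def)
  with that[of A] deriv lim show ?thesis by (simp add: A_def)
qed

section \<open>Expected maximum of Gaussian coordinates\<close>

text \<open>
  The Gaussian density without its normalising constant.
\<close>
abbreviation gaussian_weight :: "'a::euclidean_space \<Rightarrow> ennreal" where
  "gaussian_weight x \<equiv> ennreal (exp (- (norm x)\<^sup>2 / 2))"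

lemma gaussian_weight_prod:
  "gaussian_weight (x::'a::euclidean_space) = (\<Prod>b\<in>Basis. ennreal (exp (- (x \<bullet> b)\<^sup>2 / 2)))"
proof -
  have "- (norm x)\<^sup>2 / 2 = (\<Sum>b\<in>Basis. - (x \<bullet> b)\<^sup>2 / 2)"
    unfolding power2_norm_eq_inner euclidean_inner[of x x]
    by (simp add: sum_negf sum_divide_distrib power2_eq_square)
  then show ?thesis by (simp add: prod_ennreal exp_sum)
qed

lemma nn_integral_gaussian_weight:
  "(\<integral>\<^sup>+x. gaussian_weight (x::'a::euclidean_space) \<partial>lborel) = ennreal (sqrt (2 * pi) ^ DIM('a))"
  unfolding gaussian_weight_prod
  by (subst nn_integral_lborel_prod) (simp, simp, simp only: nn_integral_gaussian prod_constant, simp add: ennreal_power)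

lemma nn_integral_gaussian_interval:
  assumes "A 0 = 0" "\<And>x. DERIV A x :> exp (- x\<^sup>2 / 2)" "0 \<le> t"
  shows "(\<integral>\<^sup>+x. indicator {-t..t} x * ennreal (exp (- x\<^sup>2 / 2)) \<partial>lborel) = ennreal (2 * A t)"
proof -
  have "(\<integral>\<^sup>+x. indicator {-t..t} x * ennreal (exp (- x\<^sup>2 / 2)) \<partial>lborel)
      = 2 * (\<integral>\<^sup>+x. indicator {0..} x * (indicator {-t..t} x * ennreal (exp (- x\<^sup>2 / 2))) \<partial>lborel)"
    by (rule nn_integral_even) (auto split: split_indicator)
  also have "(\<integral>\<^sup>+x. indicator {0..} x * (indicator {-t..t} x * ennreal (exp (- x\<^sup>2 / 2))) \<partial>lborel)
      = (\<integral>\<^sup>+x. ennreal (exp (- x\<^sup>2 / 2)) * indicator {0..t} x \<partial>lborel)"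
    using assms(3) by (intro nn_integral_cong) (auto split: split_indicator)
  also have "\<dots> = ennreal (A t - A 0)"
    using assms by (intro nn_integral_FTC_Icc) auto
  finally show ?thesis using assms(1) by (simp add: ennreal_mult')
qed

lemma Max_le_iff_coordinates:
  fixes J :: "'a::euclidean_space set"
  assumes "finite J" "J \<noteq> {}"
  shows "Max ((\<lambda>b. \<bar>x \<bullet> b\<bar>) ` J) \<le> t \<longleftrightarrow> (\<forall>b\<in>J. \<bar>x \<bullet> b\<bar> \<le> t)"
  using assms by (subst Max_le_iff) auto

lemma nn_integral_gaussian_box:
  fixes J :: "'a::euclidean_space set"
  assumes J: "J \<subseteq> Basis" and A: "A 0 = 0" "\<And>x. DERIV A x :> exp (- x\<^sup>2 / 2)" and t: "0 \<le> t"
  shows "(\<integral>\<^sup>+x. indicator {x. \<forall>b\<in>J. \<bar>x \<bullet> b\<bar> \<le> t} x * gaussian_weight x \<partial>lborel)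
       = ennreal ((2 * A t) ^ card J * sqrt (2 * pi) ^ (DIM('a) - card J))"
proof -
  have A_nonneg: "0 \<le> A t"
    using DERIV_nonneg_imp_nondecreasing[OF t, of A] A by (metis exp_ge_zero)
  \<comment> \<open>Coordinates outside \<open>J\<close> are unconstrained and contribute a full Gaussian integral each.\<close>
  let ?f = "\<lambda>b x. (if b \<in> J then indicator {-t..t} x else 1) * exp (- x\<^sup>2 / 2)"
  have "(\<integral>\<^sup>+x. indicator {x. \<forall>b\<in>J. \<bar>x \<bullet> b\<bar> \<le> t} x * gaussian_weight x \<partial>lborel)
      = (\<integral>\<^sup>+x. (\<Prod>b\<in>Basis. ennreal (?f b (x \<bullet> b))) \<partial>lborel)"
  proof (rule nn_integral_cong)
    fix x :: 'a
    have "(indicator {x. \<forall>b\<in>J. \<bar>x \<bullet> b\<bar> \<le> t} x :: ennreal)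
        = (\<Prod>b\<in>Basis. if b \<in> J then indicator {-t..t} (x \<bullet> b) else 1)"
    proof (cases "\<forall>b\<in>J. \<bar>x \<bullet> b\<bar> \<le> t")
      case True
      then show ?thesis by (subst prod.neutral) (auto simp: abs_le_iff split: split_indicator)
    next
      case False
      then obtain b where "b \<in> J" "\<not> \<bar>x \<bullet> b\<bar> \<le> t" by blast
      then have "(\<Prod>b\<in>Basis. if b \<in> J then indicator {-t..t} (x \<bullet> b) else 1) = (0::ennreal)"
        using J by (intro prod_zero bexI[of _ b]) (auto simp: abs_le_iff split: split_indicator)
      with False show ?thesis by simp
    qed
    then show "indicator {x. \<forall>b\<in>J. \<bar>x \<bullet> b\<bar> \<le> t} x * gaussian_weight x
        = (\<Prod>b\<in>Basis. ennreal (?f b (x \<bullet> b)))"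
      unfolding gaussian_weight_prod
      by (simp only: prod.distrib[symmetric]) (intro prod.cong refl, auto split: split_indicator)
  qed
  also have "\<dots> = (\<Prod>b\<in>Basis. \<integral>\<^sup>+x. ennreal (?f b x) \<partial>lborel)"
    by (rule nn_integral_lborel_prod) auto
  also have "\<dots> = (\<Prod>b\<in>Basis. ennreal (if b \<in> J then 2 * A t else sqrt (2 * pi)))"
    using nn_integral_gaussian_interval[OF A t] nn_integral_gaussian
    by (intro prod.cong refl) (auto simp: ennreal_mult' ennreal_indicator)
  also have "\<dots> = ennreal (\<Prod>b\<in>Basis. if b \<in> J then 2 * A t else sqrt (2 * pi))"
    using A_nonneg by (intro prod_ennreal) auto
  also have "(\<Prod>b\<in>Basis. if b \<in> J then 2 * A t else sqrt (2 * pi))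
      = (2 * A t) ^ card J * sqrt (2 * pi) ^ (DIM('a) - card J)"
  proof -
    have "Basis \<inter> J = J" "Basis \<inter> - J = Basis - J" using J by auto
    moreover have "card (Basis - J) = DIM('a) - card J"
      using J finite_subset[OF J finite_Basis] by (intro card_Diff_subset)
    ultimately show ?thesis by (subst prod.If_cases) simp_all
  qed
  finally show ?thesis .
qed

text \<open>
  Negative values of \<open>f\<close> are harmless: they contribute \<open>0\<close> to both sides.
\<close>
lemma nn_integral_layer_cake:
  assumes [measurable]: "f \<in> borel_measurable M" and M: "sigma_finite_measure M"
  shows "(\<integral>\<^sup>+x. ennreal (f x) \<partial>M) = (\<integral>\<^sup>+t. indicator {0..} t * emeasure M {x\<in>space M. t < f x} \<partial>lborel)"
proof -
  interpret sigma_finite_measure M by fact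
  interpret pair_sigma_finite M "lborel :: real measure" ..
  have "(\<integral>\<^sup>+x. ennreal (f x) \<partial>M) = (\<integral>\<^sup>+x. \<integral>\<^sup>+t. indicator {0..} t * indicator {t. t < f x} t \<partial>lborel \<partial>M)"
  proof (rule nn_integral_cong)
    fix x
    have "(\<integral>\<^sup>+t. indicator {0..} t * indicator {t. t < f x} t \<partial>lborel) = (\<integral>\<^sup>+t. indicator {0..<f x} t \<partial>lborel)"
      by (intro nn_integral_cong) (auto split: split_indicator)
    also have "\<dots> = ennreal (f x)"
      by (cases "0 \<le> f x") (auto simp: ennreal_neg)
    finally show "ennreal (f x) = (\<integral>\<^sup>+t. indicator {0..} t * indicator {t. t < f x} t \<partial>lborel)" ..
  qed
  also have "\<dots> = (\<integral>\<^sup>+t. \<integral>\<^sup>+x. indicator {0..} t * indicator {t. t < f x} t \<partial>M \<partial>lborel)"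
    by (rule Fubini'[symmetric]) measurable
  also have "\<dots> = (\<integral>\<^sup>+t. indicator {0..} t * emeasure M {x\<in>space M. t < f x} \<partial>lborel)"
  proof (rule nn_integral_cong)
    fix t
    have "(\<integral>\<^sup>+x. indicator {0..} t * indicator {t. t < f x} t \<partial>M)
        = (\<integral>\<^sup>+x. indicator {0..} t * indicator {x\<in>space M. t < f x} x \<partial>M)"
      by (intro nn_integral_cong) (auto split: split_indicator)
    then show "(\<integral>\<^sup>+x. indicator {0..} t * indicator {t. t < f x} t \<partial>M)
        = indicator {0..} t * emeasure M {x\<in>space M. t < f x}"
      by (simp add: nn_integral_cmult_indicator)
  qed
  finally show ?thesis .
qed

lemma ennreal_gaussian_antiderivative:
  assumes A: "A 0 = 0" "\<And>x. DERIV A x :> exp (- x\<^sup>2 / 2)" and s: "0 < s"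
  shows "ennreal (A s) = ennreal s * (\<integral>\<^sup>+u. indicator {0..1} u * ennreal (exp (- (s * u)\<^sup>2 / 2)) \<partial>lborel)"
proof -
  have "ennreal (A s) = (\<integral>\<^sup>+x. ennreal (exp (- x\<^sup>2 / 2)) * indicator {0..s} x \<partial>lborel)"
    using nn_integral_FTC_Icc[of "\<lambda>x. exp (- x\<^sup>2 / 2)" 0 s A] A s by simp
  also have "\<dots> = ennreal s * (\<integral>\<^sup>+u. ennreal (exp (- (s * u)\<^sup>2 / 2)) * indicator {0..s} (s * u) \<partial>lborel)"
    using s by (subst nn_integral_real_affine[where c = s and t = 0]) simp_all
  also have "(\<integral>\<^sup>+u. ennreal (exp (- (s * u)\<^sup>2 / 2)) * indicator {0..s} (s * u) \<partial>lborel)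
      = (\<integral>\<^sup>+u. indicator {0..1} u * ennreal (exp (- (s * u)\<^sup>2 / 2)) \<partial>lborel)"
    using s by (intro nn_integral_cong) (auto simp: zero_le_mult_iff split: split_indicator)
  finally show ?thesis .
qed

text \<open>
  Rescaling each of the \<open>n\<close> integrals \<open>A s = \<integral>\<^sub>0\<^sup>s\<close> to the unit interval collects the Gaussian factors
  into one with variance depending on \<open>1 + u\<^sub>1\<^sup>2 + \<cdots> + u\<^sub>n\<^sup>2\<close>.
\<close>
lemma gaussian_power_as_cube_integral:
  assumes A: "A 0 = 0" "\<And>x. DERIV A x :> exp (- x\<^sup>2 / 2)" and s: "0 < s"
  shows "ennreal (s * (A s ^ n * exp (- s\<^sup>2 / 2)))
    = (\<integral>\<^sup>+u. (\<Prod>i=1..n. indicator {0..1} (u i))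
        * ennreal (s ^ (n + 1) * exp (- (sqrt (1 + (\<Sum>i=1..n. (u i)\<^sup>2)) * s)\<^sup>2 / 2)) \<partial>(\<Pi>\<^sub>M i\<in>{1..n}. lborel))"
proof -
  interpret product_sigma_finite "\<lambda>_::nat. lborel :: real measure" ..
  have A_nonneg: "0 \<le> A s"
    using DERIV_nonneg_imp_nondecreasing[of 0 s A] A s by (metis exp_ge_zero less_imp_le)
  let ?c = "ennreal (s ^ (n + 1) * exp (- s\<^sup>2 / 2))"
  have "ennreal (s * (A s ^ n * exp (- s\<^sup>2 / 2))) = ennreal s * ennreal (exp (- s\<^sup>2 / 2)) * ennreal (A s) ^ n"
    using s A_nonneg by (simp add: ennreal_mult ennreal_power mult_ac)
  also have "\<dots> = ?c * (\<Prod>i=1..n. \<integral>\<^sup>+u. indicator {0..1} u * ennreal (exp (- (s * u)\<^sup>2 / 2)) \<partial>lborel)"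
    unfolding ennreal_gaussian_antiderivative[OF A s] using s
    by (simp add: power_mult_distrib ennreal_mult ennreal_power[symmetric] mult_ac)
  also have "\<dots> = ?c * (\<integral>\<^sup>+u. (\<Prod>i=1..n. indicator {0..1} (u i) * ennreal (exp (- (s * u i)\<^sup>2 / 2)))
      \<partial>(\<Pi>\<^sub>M i\<in>{1..n}. lborel))"
    by (subst product_nn_integral_prod) simp_all
  also have "\<dots> = (\<integral>\<^sup>+u. ?c * (\<Prod>i=1..n. indicator {0..1} (u i) * ennreal (exp (- (s * u i)\<^sup>2 / 2)))
      \<partial>(\<Pi>\<^sub>M i\<in>{1..n}. lborel))"
    by (rule nn_integral_cmult[symmetric]) measurable
  also have "\<dots> = (\<integral>\<^sup>+u. (\<Prod>i=1..n. indicator {0..1} (u i))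
        * ennreal (s ^ (n + 1) * exp (- (sqrt (1 + (\<Sum>i=1..n. (u i)\<^sup>2)) * s)\<^sup>2 / 2)) \<partial>(\<Pi>\<^sub>M i\<in>{1..n}. lborel))"
  proof (rule nn_integral_cong)
    fix u :: "nat \<Rightarrow> real"
    have nonneg: "0 \<le> 1 + (\<Sum>i=1..n. (u i)\<^sup>2)" by (intro add_nonneg_nonneg sum_nonneg) auto
    have "- (sqrt (1 + (\<Sum>i=1..n. (u i)\<^sup>2)) * s)\<^sup>2 / 2 = - s\<^sup>2 / 2 + (\<Sum>i=1..n. - (s * u i)\<^sup>2 / 2)"
      unfolding power_mult_distrib real_sqrt_pow2[OF nonneg]
      by (simp add: sum_negf sum_distrib_left[symmetric] sum_divide_distrib[symmetric] algebra_simps add_divide_distrib)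
         (simp add: field_simps)
    then have "exp (- (sqrt (1 + (\<Sum>i=1..n. (u i)\<^sup>2)) * s)\<^sup>2 / 2)
        = exp (- s\<^sup>2 / 2) * (\<Prod>i=1..n. exp (- (s * u i)\<^sup>2 / 2))"
      by (simp only: exp_add exp_sum[OF finite_atLeastAtMost])
    then have e: "ennreal (s ^ (n + 1) * exp (- (sqrt (1 + (\<Sum>i=1..n. (u i)\<^sup>2)) * s)\<^sup>2 / 2))
        = ?c * (\<Prod>i=1..n. ennreal (exp (- (s * u i)\<^sup>2 / 2)))"
      using s by (subst prod_ennreal, simp, subst ennreal_mult[symmetric]) (auto intro!: prod_nonneg simp: mult_ac)
    show "?c * (\<Prod>i=1..n. indicator {0..1} (u i) * ennreal (exp (- (s * u i)\<^sup>2 / 2)))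
        = (\<Prod>i=1..n. indicator {0..1} (u i))
          * ennreal (s ^ (n + 1) * exp (- (sqrt (1 + (\<Sum>i=1..n. (u i)\<^sup>2)) * s)\<^sup>2 / 2))"
      unfolding e prod.distrib by (simp only: mult_ac)
  qed
  finally show ?thesis .
qed

lemma measurable_cube_kernel:
  "(\<lambda>(u, s). indicator {0..} s * ((\<Prod>i=1..n. indicator {0..1} (u i))
        * ennreal (s ^ (n + 1) * exp (- (sqrt (1 + (\<Sum>i=1..n. (u i)\<^sup>2)) * s)\<^sup>2 / 2))))
    \<in> borel_measurable ((\<Pi>\<^sub>M i\<in>{1..n::nat}. lborel) \<Otimes>\<^sub>M (lborel :: real measure))"
  by measurable

text \<open>
  Integrating over \<open>s\<close> first, for a fixed point \<open>u\<close> of the cube, leaves a multiple of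
  \<open>(1 + \<bar>u\<bar>\<^sup>2)\<close> to the power \<open>- (p + 1) / 2\<close>, which is the cube form of \<open>ds_integral\<close>.
\<close>
lemma nn_integral_gaussian_power:
  assumes A: "A 0 = 0" "\<And>x. DERIV A x :> exp (- x\<^sup>2 / 2)" and p: "1 \<le> p"
  shows "(\<integral>\<^sup>+s. indicator {0..} s * ennreal (s * (A s ^ (p - 1) * exp (- s\<^sup>2 / 2))) \<partial>lborel)
    = ennreal (half_moment p * ds_integral p)"
proof -
  obtain n where n: "p = n + 1" using p by (metis le_add_diff_inverse2)
  interpret product_sigma_finite "\<lambda>_::nat. lborel :: real measure" ..
  interpret cube: finite_product_sigma_finite "\<lambda>_::nat. lborel :: real measure" "{1..n}"
    by standard simp
  interpret pair_sigma_finite "\<Pi>\<^sub>M i\<in>{1..n}. lborel :: real measure" "lborel :: real measure" ..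
  let ?P = "\<lambda>u::nat\<Rightarrow>real. (\<Prod>i=1..n. indicator {0..1} (u i)) :: ennreal"
  let ?c = "\<lambda>u::nat\<Rightarrow>real. sqrt (1 + (\<Sum>i=1..n. (u i)\<^sup>2))"
  let ?k = "\<lambda>u s. ennreal (s ^ (n + 1) * exp (- (?c u * s)\<^sup>2 / 2))"
  have "(\<integral>\<^sup>+s. indicator {0..} s * ennreal (s * (A s ^ n * exp (- s\<^sup>2 / 2))) \<partial>lborel)
      = (\<integral>\<^sup>+s. \<integral>\<^sup>+u. indicator {0..} s * (?P u * ?k u s) \<partial>(\<Pi>\<^sub>M i\<in>{1..n}. lborel) \<partial>lborel)"
  proof (rule nn_integral_cong)
    fix s :: real
    consider "s < 0" | "s = 0" | "0 < s" by linarith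
    then show "indicator {0..} s * ennreal (s * (A s ^ n * exp (- s\<^sup>2 / 2)))
        = (\<integral>\<^sup>+u. indicator {0..} s * (?P u * ?k u s) \<partial>(\<Pi>\<^sub>M i\<in>{1..n}. lborel))"
    proof cases
      case 3
      show ?thesis
        unfolding gaussian_power_as_cube_integral[OF A 3] using 3 by simp
    qed simp_all
  qed
  also have "\<dots> = (\<integral>\<^sup>+u. \<integral>\<^sup>+s. indicator {0..} s * (?P u * ?k u s) \<partial>lborel \<partial>(\<Pi>\<^sub>M i\<in>{1..n}. lborel))"
    by (rule Fubini'[OF measurable_cube_kernel])
  also have "\<dots> = (\<integral>\<^sup>+u. ennreal (half_moment p) * (?P u * ennreal (1 / ?c u ^ (p + 1))) \<partial>(\<Pi>\<^sub>M i\<in>{1..n}. lborel))"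
  proof (rule nn_integral_cong)
    fix u :: "nat \<Rightarrow> real"
    have "0 < 1 + (\<Sum>i=1..n. (u i)\<^sup>2)" by (intro add_pos_nonneg sum_nonneg) auto
    then have c: "0 < ?c u" by (rule real_sqrt_gt_zero)
    have "(\<integral>\<^sup>+s. indicator {0..} s * (?P u * ?k u s) \<partial>lborel)
        = ?P u * (\<integral>\<^sup>+s. indicator {0..} s * ?k u s \<partial>lborel)"
      by (subst nn_integral_cmult[symmetric]) (auto simp: mult_ac)
    also have "(\<integral>\<^sup>+s. indicator {0..} s * ?k u s \<partial>lborel) = ennreal (half_moment p / ?c u ^ (p + 1))"
      unfolding n by (rule nn_integral_scaled_half_moment[OF c])
    also have "\<dots> = ennreal (half_moment p) * ennreal (1 / ?c u ^ (p + 1))"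
      using c half_moment_nonneg[of p] by (subst ennreal_mult[symmetric]) simp_all
    finally show "(\<integral>\<^sup>+s. indicator {0..} s * (?P u * ?k u s) \<partial>lborel)
        = ennreal (half_moment p) * (?P u * ennreal (1 / ?c u ^ (p + 1)))"
      by (simp only: mult_ac)
  qed
  also have "\<dots> = ennreal (half_moment p) * (\<integral>\<^sup>+u. ?P u * ennreal (1 / ?c u ^ (p + 1)) \<partial>(\<Pi>\<^sub>M i\<in>{1..n}. lborel))"
    by (rule nn_integral_cmult) measurable
  also have "\<dots> = ennreal (half_moment p) * ennreal (ds_integral p)"
    using ds_integral_eq_cube[OF p] unfolding n by simp
  also have "\<dots> = ennreal (half_moment p * ds_integral p)"
    by (rule ennreal_mult'[OF half_moment_nonneg, symmetric])
  finally show ?thesis by (simp add: n)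
qed

text \<open>
  The maximum of \<open>p\<close> coordinates exceeds \<open>t\<close> with weight proportional to
  \<open>(2\<pi>)\<^sup>p\<^sup>/\<^sup>2 - (2 A t)\<^sup>p\<close>. By the fundamental theorem of calculus this is the integral over \<open>s \<ge> t\<close> of
  the derivative \<open>w s\<close> of \<open>(2 A s)\<^sup>p\<close>; exchanging the integrals over \<open>s\<close> and \<open>t\<close> gives \<open>\<integral> s w s ds\<close>.
\<close>
lemma nn_integral_gaussian_Max:
  fixes J :: "'a::euclidean_space set"
  assumes J: "J \<subseteq> Basis" "J \<noteq> {}"
  shows "(\<integral>\<^sup>+x. ennreal (Max ((\<lambda>b. \<bar>x \<bullet> b\<bar>) ` J)) * gaussian_weight x \<partial>lborel)
    = ennreal (sqrt (2 * pi) ^ (DIM('a) - card J) * (real (card J) * 2 ^ card J * half_moment (card J)) * ds_integral (card J))"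
proof -
  obtain A where A: "A 0 = 0" "\<And>x. DERIV A x :> exp (- x\<^sup>2 / 2)" and lim: "(A \<longlongrightarrow> sqrt (pi / 2)) at_top"
    using gaussian_antiderivative by blast
  define p where "p = card J"
  define Z where "Z = sqrt (2 * pi)"
  have fin: "finite J" using J(1) finite_Basis by (rule finite_subset)
  have p: "1 \<le> p" using fin J(2) by (simp add: p_def Suc_le_eq card_gt_0_iff)
  have p_le: "p \<le> DIM('a)" unfolding p_def using J(1) by (intro card_mono) auto
  have Z: "0 < Z" by (simp add: Z_def)
  have A_nonneg: "0 \<le> A s" if "0 \<le> s" for s
    using DERIV_nonneg_imp_nondecreasing[OF that, of A] A by (metis exp_ge_zero)
  have [measurable]: "A \<in> borel_measurable borel"
    using A(2) by (intro borel_measurable_continuous_onI continuous_at_imp_continuous_on ballI DERIV_isCont)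
  let ?F = "\<lambda>x. Max ((\<lambda>b. \<bar>x \<bullet> b\<bar>) ` J)"
  have F[measurable]: "?F \<in> borel_measurable borel"
    using fin J(2) by (intro borel_measurable_Max) auto
  define w where "w s = real p * (2 * A s) ^ (p - 1) * (2 * exp (- s\<^sup>2 / 2))" for s
  have [measurable]: "w \<in> borel_measurable borel" unfolding w_def by measurable
  define \<mu> where "\<mu> = density lborel (gaussian_weight :: 'a \<Rightarrow> ennreal)"
  have sets_\<mu>[measurable_cong]: "sets \<mu> = sets borel" and space_\<mu>: "space \<mu> = UNIV"
    by (simp_all add: \<mu>_def)
  have total: "emeasure \<mu> UNIV = ennreal (Z ^ DIM('a))"
  proof -
    have "emeasure \<mu> UNIV = (\<integral>\<^sup>+x. gaussian_weight (x :: 'a) \<partial>lborel)"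
      by (simp add: \<mu>_def emeasure_density)
    then show ?thesis by (simp only: nn_integral_gaussian_weight Z_def)
  qed
  interpret \<mu>: finite_measure \<mu>
    by (rule finite_measureI) (simp add: space_\<mu> total)
  have tail: "emeasure \<mu> {x. t < ?F x}
      = ennreal (Z ^ (DIM('a) - p)) * (\<integral>\<^sup>+s. ennreal (w s) * indicator {t..} s \<partial>lborel)" if t: "0 \<le> t" for t
  proof -
    have meas: "{x. ?F x \<le> t} \<in> sets \<mu>" by measurable
    have "emeasure \<mu> {x. ?F x \<le> t} = (\<integral>\<^sup>+x. indicator {x. \<forall>b\<in>J. \<bar>x \<bullet> b\<bar> \<le> t} x * gaussian_weight x \<partial>lborel)"
      using meas by (simp add: \<mu>_def emeasure_density Max_le_iff_coordinates[OF fin J(2)] mult.commute)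
    also have "\<dots> = ennreal ((2 * A t) ^ p * Z ^ (DIM('a) - p))"
      unfolding p_def Z_def by (rule nn_integral_gaussian_box[OF J(1) A t])
    finally have box: "emeasure \<mu> {x. ?F x \<le> t} = ennreal ((2 * A t) ^ p * Z ^ (DIM('a) - p))" .
    have "{x. t < ?F x} = space \<mu> - {x. ?F x \<le> t}" by (auto simp: space_\<mu>)
    then have "emeasure \<mu> {x. t < ?F x} = ennreal (Z ^ DIM('a)) - ennreal ((2 * A t) ^ p * Z ^ (DIM('a) - p))"
      using emeasure_compl[OF meas] by (simp add: box space_\<mu> total)
    also have "\<dots> = ennreal (Z ^ DIM('a) - (2 * A t) ^ p * Z ^ (DIM('a) - p))"
      using A_nonneg[OF t] Z by (intro ennreal_minus) auto
    also have "Z ^ DIM('a) - (2 * A t) ^ p * Z ^ (DIM('a) - p) = Z ^ (DIM('a) - p) * (Z ^ p - (2 * A t) ^ p)"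
      using p_le by (simp add: algebra_simps flip: power_add)
    also have "ennreal \<dots> = ennreal (Z ^ (DIM('a) - p)) * ennreal (Z ^ p - (2 * A t) ^ p)"
      using Z by (intro ennreal_mult') simp
    also have "ennreal (Z ^ p - (2 * A t) ^ p) = (\<integral>\<^sup>+s. ennreal (w s) * indicator {t..} s \<partial>lborel)"
    proof (rule nn_integral_FTC_atLeast[symmetric])
      fix s assume "t \<le> s"
      then show "0 \<le> w s" using A_nonneg[of s] t by (simp add: w_def)
      show "DERIV (\<lambda>s. (2 * A s) ^ p) s :> w s"
        unfolding w_def using DERIV_power[OF DERIV_cmult[OF A(2)[of s], of 2], of p] by (simp add: mult_ac)
    next
      have "2 * sqrt (pi / 2) = Z"
      proof -
        have "2 * sqrt (pi / 2) = sqrt (4 * (pi / 2))" by (simp only: real_sqrt_mult real_sqrt_four)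
        then show ?thesis by (simp add: Z_def)
      qed
      then show "((\<lambda>s. (2 * A s) ^ p) \<longlongrightarrow> Z ^ p) at_top"
        using tendsto_power[OF tendsto_mult[OF tendsto_const lim], of 2 p] by simp
    qed measurable
    finally show ?thesis .
  qed
  have swap: "indicator {..s} t = (indicator {t..} s :: ennreal)" for s t :: real
    by (simp add: indicator_def)
  let ?Z = "ennreal (Z ^ (DIM('a) - p))"
  have "(\<integral>\<^sup>+x. ennreal (?F x) * gaussian_weight x \<partial>lborel) = (\<integral>\<^sup>+x. ennreal (?F x) \<partial>\<mu>)"
    unfolding \<mu>_def by (subst nn_integral_density) (auto simp: mult.commute)
  also have "\<dots> = (\<integral>\<^sup>+t. indicator {0..} t * emeasure \<mu> {x\<in>space \<mu>. t < ?F x} \<partial>lborel)"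
    by (rule nn_integral_layer_cake) (measurable, rule \<mu>.sigma_finite_measure_axioms)
  also have "\<dots> = (\<integral>\<^sup>+t. ?Z * (\<integral>\<^sup>+s. indicator {0..} t * (ennreal (w s) * indicator {..s} t) \<partial>lborel) \<partial>lborel)"
    unfolding swap
    by (intro nn_integral_cong) (auto simp: tail space_\<mu> nn_integral_cmult split: split_indicator)
  also have "\<dots> = ?Z * (\<integral>\<^sup>+t. \<integral>\<^sup>+s. indicator {0..} t * (ennreal (w s) * indicator {..s} t) \<partial>lborel \<partial>lborel)"
    by (rule nn_integral_cmult) (unfold indicator_def atMost_iff, measurable)
  also have "(\<integral>\<^sup>+t. \<integral>\<^sup>+s. indicator {0..} t * (ennreal (w s) * indicator {..s} t) \<partial>lborel \<partial>lborel)
      = (\<integral>\<^sup>+s. \<integral>\<^sup>+t. indicator {0..} t * (ennreal (w s) * indicator {..s} t) \<partial>lborel \<partial>lborel)"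
    unfolding indicator_def atMost_iff by (rule lborel_pair.Fubini') measurable
  also have "\<dots> = (\<integral>\<^sup>+s. ennreal (real p * 2 ^ p) * (indicator {0..} s * ennreal (s * (A s ^ (p - 1) * exp (- s\<^sup>2 / 2)))) \<partial>lborel)"
  proof (rule nn_integral_cong)
    fix s :: real
    have "(\<integral>\<^sup>+t. indicator {0..} t * (ennreal (w s) * indicator {..s} t) \<partial>lborel)
        = (\<integral>\<^sup>+t. ennreal (w s) * indicator {0..s} t \<partial>lborel)"
      by (intro nn_integral_cong) (auto split: split_indicator)
    also have "\<dots> = ennreal (w s) * (indicator {0..} s * ennreal s)"
      by (cases "0 \<le> s") (auto simp: nn_integral_cmult_indicator)
    also have "\<dots> = indicator {0..} s * ennreal (w s * s)"
      by (auto simp: ennreal_mult'' split: split_indicator)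
    also have "w s * s = real p * 2 ^ p * (s * (A s ^ (p - 1) * exp (- s\<^sup>2 / 2)))"
    proof -
      have "(2::real) ^ p = 2 * 2 ^ (p - 1)" using p by (cases p) auto
      then show ?thesis unfolding w_def power_mult_distrib by (simp only: mult_ac)
    qed
    finally have layer: "(\<integral>\<^sup>+t. indicator {0..} t * (ennreal (w s) * indicator {..s} t) \<partial>lborel)
        = indicator {0..} s * ennreal (real p * 2 ^ p * (s * (A s ^ (p - 1) * exp (- s\<^sup>2 / 2))))" .
    have factor: "ennreal (real p * 2 ^ p * y) = ennreal (real p * 2 ^ p) * ennreal y" for y
      by (rule ennreal_mult') simp
    show "(\<integral>\<^sup>+t. indicator {0..} t * (ennreal (w s) * indicator {..s} t) \<partial>lborel)
        = ennreal (real p * 2 ^ p) * (indicator {0..} s * ennreal (s * (A s ^ (p - 1) * exp (- s\<^sup>2 / 2))))"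
      unfolding layer factor by (rule mult.left_commute)
  qed
  also have "\<dots> = ennreal (real p * 2 ^ p) * ennreal (half_moment p * ds_integral p)"
    by (subst nn_integral_cmult, measurable) (simp only: nn_integral_gaussian_power[OF A p])
  also have "?Z * \<dots> = ennreal (Z ^ (DIM('a) - p) * (real p * 2 ^ p * half_moment p) * ds_integral p)"
    using Z by (simp add: ennreal_mult'[symmetric] mult.assoc)
  finally show ?thesis unfolding p_def Z_def .
qed

section \<open>Uniqueness of rotation invariant measures\<close>

text \<open>
  Christensen's lemma: two measures that are carried by \<open>S\<close> and give every ball of radius \<open>r\<close>
  centred in \<open>S\<close> the same measure \<open>c r\<close> are equal. For an open set \<open>U\<close> let \<open>V r\<close> be the points whose
  \<open>r\<close>-ball lies in \<open>U\<close>. Integrating the kernel \<open>dist x y < r\<close> over \<open>V r \<times> U\<close> in both orders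
  gives \<open>c r * N (V r) \<le> c r * N' U\<close>, and \<open>V r\<close> increases to \<open>U\<close> as \<open>r\<close> decreases to \<open>0\<close>. The lemma
  is used twice: on the whole space for the rotation invariance of Lebesgue measure, and on the
  sphere for the uniqueness of the uniform distribution.
\<close>
lemma uniformly_distributed_measures_eq:
  fixes N N' :: "'a::{metric_space, second_countable_topology} measure"
  assumes a: "a \<in> S"
    and sets: "sets N = sets borel" "sets N' = sets borel"
    and AE: "AE x in N. x \<in> S" "AE x in N'. x \<in> S"
    and ball: "\<And>x r. x \<in> S \<Longrightarrow> 0 < r \<Longrightarrow> emeasure N (ball x r) = c r"
              "\<And>x r. x \<in> S \<Longrightarrow> 0 < r \<Longrightarrow> emeasure N' (ball x r) = c r"
    and c: "\<And>r. 0 < r \<Longrightarrow> c r \<noteq> 0" "\<And>r. 0 < r \<Longrightarrow> c r \<noteq> \<infinity>"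
  shows "N = N'"
proof -
  have cover: "(\<Union>n. ball a (real (Suc n))) = UNIV"
  proof safe
    fix x
    obtain n where "dist a x < real n" using reals_Archimedean2 by blast
    then show "x \<in> (\<Union>n. ball a (real (Suc n)))" by (auto intro!: exI[of _ n])
  qed auto
  have finite: "sigma_finite_measure N"
    if "sets N = sets borel" and ball: "\<And>x r. x \<in> S \<Longrightarrow> 0 < r \<Longrightarrow> emeasure N (ball x r) = c r" for N :: "'a measure"
  proof
    show "\<exists>A. countable A \<and> A \<subseteq> sets N \<and> \<Union>A = space N \<and> (\<forall>a\<in>A. emeasure N a \<noteq> \<infinity>)"
      using cover c(2) ball[OF a] sets_eq_imp_space_eq[OF that(1)] that(1)
      by (intro exI[of _ "range (\<lambda>n. ball a (real (Suc n)))"]) auto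
  qed
  note N = finite[OF sets(1) ball(1)] sets(1) AE(1)
  note N' = finite[OF sets(2) ball(2)] sets(2) AE(2)
  have le: "emeasure N U \<le> emeasure N' U"
    if "open U"
      and N: "sigma_finite_measure N" "sets N = sets borel" "AE x in N. x \<in> S"
      and N': "sigma_finite_measure N'" "sets N' = sets borel" "AE x in N'. x \<in> S"
      and ball: "\<And>x r. x \<in> S \<Longrightarrow> 0 < r \<Longrightarrow> emeasure N (ball x r) = c r"
                "\<And>x r. x \<in> S \<Longrightarrow> 0 < r \<Longrightarrow> emeasure N' (ball x r) = c r"
    for N N' :: "'a measure" and U
  proof -
    interpret N: sigma_finite_measure N by fact
    interpret N': sigma_finite_measure N' by fact
    interpret pair_sigma_finite N N' ..
    note [measurable_cong] = N(2) N'(2)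
    have [measurable]: "U \<in> sets borel" using \<open>open U\<close> by simp
    define V where "V r = {x. ball x r \<subseteq> U}" for r
    have V_sets [measurable]: "V r \<in> sets borel" if "0 < r" for r
    proof -
      have "- V r = (\<Union>y\<in>-U. ball y r)"
        by (auto simp: V_def dist_commute)
      then have "open (- V r)" by auto
      then show ?thesis by (metis borel_closed closed_def)
    qed
    have V_le: "emeasure N (V r) \<le> emeasure N' U" if r: "0 < r" for r
    proof -
      note [measurable] = V_sets[OF r]
      have "c r * emeasure N (V r) = (\<integral>\<^sup>+x. indicator (V r) x * c r \<partial>N)"
        by (simp add: nn_integral_multc N mult.commute[of "c r"] del: nn_integral_indicator_singleton)
      also have "\<dots> = (\<integral>\<^sup>+x. indicator (V r) x * emeasure N' (ball x r) \<partial>N)"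
        using N(3) by (intro nn_integral_cong_AE) (auto simp: ball r)
      also have "\<dots> = (\<integral>\<^sup>+x. \<integral>\<^sup>+y. indicator (V r) x * indicator {..<r} (dist x y) \<partial>N' \<partial>N)"
        by (auto intro!: nn_integral_cong simp: nn_integral_cmult N'
            simp flip: nn_integral_indicator split: split_indicator)
      also have "\<dots> = (\<integral>\<^sup>+y. \<integral>\<^sup>+x. indicator (V r) x * indicator {..<r} (dist x y) \<partial>N \<partial>N')"
        by (rule Fubini'[symmetric]) measurable
      also have "\<dots> \<le> (\<integral>\<^sup>+y. \<integral>\<^sup>+x. indicator U y * indicator (ball y r) x \<partial>N \<partial>N')"
      proof (intro nn_integral_mono)
        fix x y
        have "y \<in> U" if "x \<in> V r" "dist x y < r"
          using that by (auto simp: V_def)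
        then show "indicator (V r) x * indicator {..<r} (dist x y)
            \<le> (indicator U y * indicator (ball y r) x :: ennreal)"
          by (auto simp: dist_commute[of y x] split: split_indicator)
      qed
      also have "\<dots> = (\<integral>\<^sup>+y. indicator U y * emeasure N (ball y r) \<partial>N')"
        by (simp add: nn_integral_cmult_indicator N)
      also have "\<dots> = (\<integral>\<^sup>+y. indicator U y * c r \<partial>N')"
        using N'(3) by (intro nn_integral_cong_AE) (auto simp: ball r)
      also have "\<dots> = c r * emeasure N' U"
        by (simp add: nn_integral_multc N' mult.commute[of "c r"])
      finally show ?thesis
        using c[OF r] by (simp add: ennreal_mult_le_mult_iff)
    qed
    have "(\<Union>n. V (1 / Suc n)) = U"
    proof safe
      fix x n assume "x \<in> V (1 / Suc n)" then show "x \<in> U" by (auto simp: V_def)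
    next
      fix x assume "x \<in> U"
      then obtain e where "e > 0" "ball x e \<subseteq> U" using \<open>open U\<close> open_contains_ball by blast
      moreover obtain n where "1 / Suc n < e" using \<open>e > 0\<close> nat_approx_posE by blast
      ultimately have "x \<in> V (1 / Suc n)"
        unfolding V_def using subset_ball[of "1 / Suc n" e x] by auto
      then show "x \<in> (\<Union>n. V (1 / Suc n))" by blast
    qed
    moreover have "incseq (\<lambda>n. V (1 / Suc n))"
    proof (intro incseq_SucI subsetI)
      fix n x assume "x \<in> V (1 / Suc n)"
      moreover have "1 / real (Suc (Suc n)) \<le> 1 / Suc n" by (simp add: frac_le)
      ultimately show "x \<in> V (1 / Suc (Suc n))" unfolding V_def using subset_ball by blast
    qed
    ultimately have "emeasure N U = (SUP n. emeasure N (V (1 / Suc n)))"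
      by (subst SUP_emeasure_incseq) (auto simp: N intro!: V_sets)
    also have "\<dots> \<le> emeasure N' U" by (intro SUP_least V_le) simp
    finally show ?thesis .
  qed
  have eq: "emeasure N U = emeasure N' U" if "open U" for U
    using le[OF that N N' ball] le[OF that N' N ball(2,1)] by simp
  show ?thesis
  proof (rule measure_eqI_generator_eq)
    show "Int_stable {U :: 'a set. open U}" by (auto simp: Int_stable_def)
    show "sets N = sigma_sets UNIV {U. open U}" "sets N' = sigma_sets UNIV {U. open U}"
      using N(2) N'(2) by (auto simp: borel_def)
    show "range (\<lambda>n. ball a (real (Suc n))) \<subseteq> {U. open U}" by auto
    show "(\<Union>n. ball a (real (Suc n))) = UNIV" by (rule cover)
    show "emeasure N (ball a (real (Suc n))) \<noteq> \<infinity>" for n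
      using ball(1)[OF a] c(2) by simp
  qed (auto simp: eq)
qed

lemma distr_lborel_orthogonal:
  fixes f :: "'a::euclidean_space \<Rightarrow> 'a"
  assumes f: "orthogonal_transformation f"
  shows "distr lborel borel f = lborel"
proof (rule uniformly_distributed_measures_eq[where S = UNIV and c = "\<lambda>r. ennreal (unit_ball_vol (DIM('a)) * r ^ DIM('a))"])
  have [measurable]: "f \<in> borel_measurable borel"
    using orthogonal_transformation_linear[OF f] by (intro borel_measurable_continuous_onI linear_continuous_on linear_conv_bounded_linear[THEN iffD1])
  fix x :: 'a and r :: real assume r: "0 < r"
  show "emeasure lborel (ball x r) = ennreal (unit_ball_vol (DIM('a)) * r ^ DIM('a))"
    using r by (intro emeasure_ball) simp
  obtain y where x: "x = f y"
    using orthogonal_transformation_surj[OF f] by (metis surjD)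
  have "f -` ball x r = ball y r"
    unfolding x using f by (auto simp: orthogonal_transformation_isometry)
  then show "emeasure (distr lborel borel f) (ball x r) = ennreal (unit_ball_vol (DIM('a)) * r ^ DIM('a))"
    using r by (simp add: emeasure_distr emeasure_ball)
next
  fix r :: real assume "0 < r"
  then show "ennreal (unit_ball_vol (DIM('a)) * r ^ DIM('a)) \<noteq> 0"
    by (simp add: ennreal_eq_0_iff not_le)
qed auto

lemma rotation_invariant_ball:
  fixes N :: "(real ^ 'd) measure"
  assumes "sets N = sets borel" and inv: "\<And>f. orthogonal_transformation f \<Longrightarrow> distr N borel f = N"
    and xy: "norm x = 1" "norm y = 1"
  shows "emeasure N (ball x r) = emeasure N (ball y r)"
proof -
  obtain f where f: "orthogonal_transformation f" "f x = y"
    using orthogonal_transformation_exists[of x y] xy by auto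
  have [measurable]: "f \<in> borel_measurable borel"
    using orthogonal_transformation_linear[OF f(1)] by (intro borel_measurable_continuous_onI linear_continuous_on linear_conv_bounded_linear[THEN iffD1])
  note [measurable_cong] = assms(1)
  have "emeasure N (ball y r) = emeasure (distr N borel f) (ball y r)"
    by (simp add: inv[OF f(1)])
  also have "\<dots> = emeasure N (f -` ball y r \<inter> space N)" by (rule emeasure_distr) auto
  also have "f -` ball y r \<inter> space N = ball x r"
    using f sets_eq_imp_space_eq[OF assms(1)] by (auto simp: orthogonal_transformation_isometry)
  finally show ?thesis ..
qed

text \<open>
  For each of the two measures, balls centred on the sphere have a measure depending only on the
  radius; integrating the kernel \<open>dist x y < r\<close> against both shows that these values agree, and
  compactness of the sphere shows that they are positive.
\<close>
lemma rotation_invariant_sphere_unique: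
  fixes N N' :: "(real ^ 'd) measure"
  assumes N: "prob_space N" "sets N = sets borel" "AE x in N. x \<in> sphere 0 1"
      "\<And>f. orthogonal_transformation f \<Longrightarrow> distr N borel f = N"
    and N': "prob_space N'" "sets N' = sets borel" "AE x in N'. x \<in> sphere 0 1"
      "\<And>f. orthogonal_transformation f \<Longrightarrow> distr N' borel f = N'"
  shows "N = N'"
proof -
  interpret N: prob_space N by fact
  interpret N': prob_space N' by fact
  interpret pair_sigma_finite N N' ..
  note [measurable_cong] = N(2) N'(2)
  obtain a :: "real ^ 'd" where a: "norm a = 1" using vector_choose_size[of 1] by auto
  have balls: "emeasure N (ball x r) = emeasure N (ball a r)" "emeasure N' (ball x r) = emeasure N' (ball a r)"
    if "x \<in> sphere 0 1" for x r
    by (rule rotation_invariant_ball[OF N(2,4)], assumption, use that a in simp_all)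
       (rule rotation_invariant_ball[OF N'(2,4)], assumption, use that a in simp_all)
  have eq: "emeasure N (ball a r) = emeasure N' (ball a r)" for r
  proof -
    have "emeasure N' (ball a r) = (\<integral>\<^sup>+x. emeasure N' (ball a r) \<partial>N)"
      by (simp add: N.emeasure_space_1)
    also have "\<dots> = (\<integral>\<^sup>+x. emeasure N' (ball x r) \<partial>N)"
      using N(3) by (intro nn_integral_cong_AE) (elim eventually_mono, rule balls(2)[symmetric])
    also have "\<dots> = (\<integral>\<^sup>+x. \<integral>\<^sup>+y. indicator {..<r} (dist x y) \<partial>N' \<partial>N)"
      by (auto intro!: nn_integral_cong simp: N' simp flip: nn_integral_indicator split: split_indicator)
    also have "\<dots> = (\<integral>\<^sup>+y. \<integral>\<^sup>+x. indicator {..<r} (dist x y) \<partial>N \<partial>N')"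
      by (rule Fubini'[symmetric]) measurable
    also have "\<dots> = (\<integral>\<^sup>+y. emeasure N (ball y r) \<partial>N')"
      by (auto intro!: nn_integral_cong simp: N dist_commute simp flip: nn_integral_indicator split: split_indicator)
    also have "\<dots> = (\<integral>\<^sup>+y. emeasure N (ball a r) \<partial>N')"
      using N'(3) by (intro nn_integral_cong_AE) (elim eventually_mono, rule balls(1))
    also have "\<dots> = emeasure N (ball a r)"
      by (simp add: N'.emeasure_space_1)
    finally show ?thesis ..
  qed
  show ?thesis
  proof (rule uniformly_distributed_measures_eq)
    show "a \<in> sphere 0 1" using a by simp
    fix r :: real assume r: "0 < r"
    show "emeasure N (ball a r) \<noteq> 0"
    proof
      assume 0: "emeasure N (ball a r) = 0"
      \<comment> \<open>Finitely many balls cover the sphere; they would all be null sets.\<close>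
      obtain C where C: "C \<subseteq> sphere (0 :: real ^ 'd) 1" "finite C" "sphere 0 1 \<subseteq> (\<Union>x\<in>C. ball x r)"
        using compactE_image[of "sphere (0 :: real ^ 'd) 1" "sphere 0 1" "\<lambda>x. ball x r"] r by force
      have "(\<Union>x\<in>C. ball x r) \<in> null_sets N"
      proof (rule null_sets_UN')
        fix x assume "x \<in> C"
        then have "emeasure N (ball x r) = 0" using balls(1)[of x r] C(1) 0 by auto
        then show "ball x r \<in> null_sets N" using N(2) by (intro null_setsI) auto
      qed (rule countable_finite[OF C(2)])
      then have "emeasure N (\<Union>x\<in>C. ball x r) = 0" by (rule null_setsD1)
      moreover have "emeasure N (\<Union>x\<in>C. ball x r) = 1"
      proof (rule N.emeasure_eq_1_AE)
        show "(\<Union>x\<in>C. ball x r) \<in> sets N" unfolding N(2) by (intro borel_open open_UN) simp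
        show "AE x in N. x \<in> (\<Union>x\<in>C. ball x r)" using N(3) by (rule eventually_mono) (rule subsetD[OF C(3)])
      qed
      ultimately show False by simp
    qed
    show "emeasure N (ball a r) \<noteq> \<infinity>" by simp
  next
    fix x r assume "x \<in> sphere (0 :: real ^ 'd) 1"
    then show "emeasure N (ball x r) = emeasure N (ball a r)" "emeasure N' (ball x r) = emeasure N (ball a r)"
      unfolding eq by (rule balls(1)[unfolded eq], rule balls(2))
  qed (fact N N')+
qed

section \<open>Expected norm of a Gaussian vector\<close>

lemma nn_integral_radial:
  fixes w :: "real \<Rightarrow> ennreal"
  assumes [measurable]: "w \<in> borel_measurable borel"
  shows "(\<integral>\<^sup>+x. (\<integral>\<^sup>+s. w s * indicator {norm (x::'a::euclidean_space)..} s \<partial>lborel) \<partial>lborel)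
    = (\<integral>\<^sup>+s. indicator {0..} s * (w s * ennreal (unit_ball_vol DIM('a) * s ^ DIM('a))) \<partial>lborel)"
proof -
  have "(\<integral>\<^sup>+x. (\<integral>\<^sup>+s. w s * indicator {norm (x::'a)..} s \<partial>lborel) \<partial>lborel)
      = (\<integral>\<^sup>+s. (\<integral>\<^sup>+x. w s * indicator {norm (x::'a)..} s \<partial>lborel) \<partial>lborel)"
    unfolding indicator_def atLeast_iff by (rule lborel_pair.Fubini'[symmetric]) measurable
  also have "\<dots> = (\<integral>\<^sup>+s. indicator {0..} s * (w s * ennreal (unit_ball_vol DIM('a) * s ^ DIM('a))) \<partial>lborel)"
  proof (rule nn_integral_cong)
    fix s :: real
    have "(\<integral>\<^sup>+x. w s * indicator {norm (x::'a)..} s \<partial>lborel) = (\<integral>\<^sup>+x. w s * indicator (cball (0::'a) s) x \<partial>lborel)"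
      by (intro nn_integral_cong) (auto split: split_indicator)
    also have "\<dots> = w s * emeasure lborel (cball (0::'a) s)"
      by (simp add: nn_integral_cmult_indicator)
    also have "\<dots> = indicator {0..} s * (w s * ennreal (unit_ball_vol DIM('a) * s ^ DIM('a)))"
      by (cases "0 \<le> s") (simp_all add: emeasure_cball)
    finally show "(\<integral>\<^sup>+x. w s * indicator {norm (x::'a)..} s \<partial>lborel)
      = indicator {0..} s * (w s * ennreal (unit_ball_vol DIM('a) * s ^ DIM('a)))" .
  qed
  finally show ?thesis .
qed

text \<open>
  Integration by parts, in a form without subtraction.
\<close>
lemma nn_integral_gaussian_tail:
  assumes r: "0 \<le> r"
  shows "(\<integral>\<^sup>+s. ennreal (s\<^sup>2 * exp (- s\<^sup>2 / 2)) * indicator {r..} s \<partial>lborel)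
    = ennreal (r * exp (- r\<^sup>2 / 2)) + (\<integral>\<^sup>+s. ennreal (exp (- s\<^sup>2 / 2)) * indicator {r..} s \<partial>lborel)"
proof -
  obtain A where A: "A 0 = 0" "\<And>x. DERIV A x :> exp (- x\<^sup>2 / 2)" and lim: "(A \<longlongrightarrow> sqrt (pi / 2)) at_top"
    using gaussian_antiderivative by blast
  have "((\<lambda>s::real. s * exp (- s\<^sup>2 / 2)) \<longlongrightarrow> 0) at_top"
  proof (rule tendsto_sandwich)
    show "eventually (\<lambda>s::real. 0 \<le> s * exp (- s\<^sup>2 / 2)) at_top"
      using eventually_ge_at_top[of 0] by (rule eventually_mono) simp
    show "eventually (\<lambda>s::real. s * exp (- s\<^sup>2 / 2) \<le> 2 * inverse s) at_top"
      using eventually_gt_at_top[of 0]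
    proof (rule eventually_mono)
      fix s :: real assume s: "0 < s"
      have "s\<^sup>2 / 2 \<le> exp (s\<^sup>2 / 2)" using exp_ge_add_one_self[of "s\<^sup>2 / 2"] by linarith
      then have "inverse (exp (s\<^sup>2 / 2)) \<le> inverse (s\<^sup>2 / 2)"
        using s by (intro le_imp_inverse_le) auto
      moreover have "exp (- s\<^sup>2 / 2) = inverse (exp (s\<^sup>2 / 2))" by (simp flip: exp_minus)
      ultimately have "s * exp (- s\<^sup>2 / 2) \<le> s * inverse (s\<^sup>2 / 2)"
        using s by (intro mult_left_mono) auto
      also have "\<dots> = 2 * inverse s" using s by (simp add: field_simps power2_eq_square)
      finally show "s * exp (- s\<^sup>2 / 2) \<le> 2 * inverse s" .
    qed
    show "((\<lambda>s::real. 2 * inverse s) \<longlongrightarrow> 0) at_top"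
      using tendsto_mult[OF tendsto_const tendsto_inverse_0_at_top[OF filterlim_ident], of 2] by simp
  qed simp
  \<comment> \<open>The function \<open>A s - s * exp (- s\<^sup>2/2)\<close> has derivative \<open>s\<^sup>2 * exp (- s\<^sup>2/2)\<close>.\<close>
  from tendsto_diff[OF lim this]
  have lim': "((\<lambda>s. A s - s * exp (- s\<^sup>2 / 2)) \<longlongrightarrow> sqrt (pi / 2)) at_top" by simp
  have "(\<integral>\<^sup>+s. ennreal (s\<^sup>2 * exp (- s\<^sup>2 / 2)) * indicator {r..} s \<partial>lborel)
      = ennreal (sqrt (pi / 2) - (A r - r * exp (- r\<^sup>2 / 2)))"
    by (rule nn_integral_FTC_atLeast[OF _ _ _ lim'])
       (auto intro!: derivative_eq_intros A(2) simp: power2_eq_square)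
  moreover have "(\<integral>\<^sup>+s. ennreal (exp (- s\<^sup>2 / 2)) * indicator {r..} s \<partial>lborel) = ennreal (sqrt (pi / 2) - A r)"
    by (rule nn_integral_FTC_atLeast[OF _ _ _ lim]) (measurable, rule A(2), simp)
  moreover have "A r \<le> sqrt (pi / 2)"
  proof (rule tendsto_lowerbound[OF lim])
    show "eventually (\<lambda>s. A r \<le> A s) at_top"
      using eventually_ge_at_top[of r]
    proof (rule eventually_mono)
      fix s assume "r \<le> s"
      then show "A r \<le> A s"
        by (rule DERIV_nonneg_imp_nondecreasing) (blast intro: A(2) exp_ge_zero)
    qed
  qed simp
  ultimately show ?thesis using r by (simp add: ennreal_plus[symmetric] algebra_simps del: ennreal_plus)
qed

text \<open>
  Writing \<open>r exp (- r\<^sup>2/2)\<close> as a difference of two tail integrals reduces the radial integral to the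
  volume of balls, with no need for polar coordinates.
\<close>
lemma nn_integral_gaussian_norm:
  "(\<integral>\<^sup>+x. ennreal (norm x) * gaussian_weight (x::'a::euclidean_space) \<partial>lborel)
    = ennreal (real DIM('a) * unit_ball_vol DIM('a) * half_moment DIM('a))"
proof -
  let ?d = "DIM('a)" let ?v = "unit_ball_vol (real DIM('a))"
  have moment: "(\<integral>\<^sup>+s. indicator {0..} s * (ennreal (s ^ k * exp (- s\<^sup>2 / 2)) * ennreal (?v * s ^ ?d)) \<partial>lborel)
      = ennreal (?v * half_moment (?d + k))" for k
  proof -
    have "(\<integral>\<^sup>+s. indicator {0..} s * (ennreal (s ^ k * exp (- s\<^sup>2 / 2)) * ennreal (?v * s ^ ?d)) \<partial>lborel)
        = (\<integral>\<^sup>+s. ennreal ?v * (indicator {0..} s * ennreal (s ^ (?d + k) * exp (- (1 * s)\<^sup>2 / 2))) \<partial>lborel)"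
    proof (rule nn_integral_cong)
      fix s :: real
      show "indicator {0..} s * (ennreal (s ^ k * exp (- s\<^sup>2 / 2)) * ennreal (?v * s ^ ?d))
          = ennreal ?v * (indicator {0..} s * ennreal (s ^ (?d + k) * exp (- (1 * s)\<^sup>2 / 2)))"
      proof (cases "0 \<le> s")
        case True
        have "ennreal (s ^ k * exp (- s\<^sup>2 / 2)) * ennreal (?v * s ^ ?d)
            = ennreal ((s ^ k * exp (- s\<^sup>2 / 2)) * (?v * s ^ ?d))"
          using True by (intro ennreal_mult[symmetric]) simp_all
        also have "(s ^ k * exp (- s\<^sup>2 / 2)) * (?v * s ^ ?d) = ?v * (s ^ (?d + k) * exp (- (1 * s)\<^sup>2 / 2))"
          by (simp only: power_add mult_1_left mult_ac)
        also have "ennreal \<dots> = ennreal ?v * ennreal (s ^ (?d + k) * exp (- (1 * s)\<^sup>2 / 2))"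
          by (rule ennreal_mult') simp
        finally show ?thesis using True by simp
      qed simp
    qed
    also have "\<dots> = ennreal ?v * ennreal (half_moment (?d + k) / 1 ^ (?d + k + 1))"
      by (subst nn_integral_cmult, measurable) (subst nn_integral_scaled_half_moment, simp_all)
    finally show ?thesis by (simp add: ennreal_mult')
  qed
  let ?K = "\<integral>\<^sup>+x. ennreal (norm x) * gaussian_weight (x::'a) \<partial>lborel"
  have tail: "(\<integral>\<^sup>+x. (\<integral>\<^sup>+s. ennreal (exp (- s\<^sup>2 / 2)) * indicator {norm (x::'a)..} s \<partial>lborel) \<partial>lborel)
      = ennreal (?v * half_moment ?d)"
    using moment[of 0] unfolding power_0 mult_1_left add_0_right by (subst nn_integral_radial, measurable)
  have "(\<integral>\<^sup>+x. ennreal (norm x) * gaussian_weight (x::'a) \<partial>lborel)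
      + (\<integral>\<^sup>+x. (\<integral>\<^sup>+s. ennreal (exp (- s\<^sup>2 / 2)) * indicator {norm (x::'a)..} s \<partial>lborel) \<partial>lborel)
      = (\<integral>\<^sup>+x. ennreal (norm x) * gaussian_weight (x::'a)
          + (\<integral>\<^sup>+s. ennreal (exp (- s\<^sup>2 / 2)) * indicator {norm (x::'a)..} s \<partial>lborel) \<partial>lborel)"
    unfolding indicator_def atLeast_iff by (rule nn_integral_add[symmetric]) measurable
  also have "\<dots> = (\<integral>\<^sup>+x. (\<integral>\<^sup>+s. ennreal (s\<^sup>2 * exp (- s\<^sup>2 / 2)) * indicator {norm (x::'a)..} s \<partial>lborel) \<partial>lborel)"
    by (simp only: nn_integral_gaussian_tail[OF norm_ge_zero] ennreal_mult'[OF norm_ge_zero])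
  also have "\<dots> = ennreal (?v * half_moment (?d + 2))"
    by (subst nn_integral_radial, measurable) (rule moment)
  finally have sum: "?K + ennreal (?v * half_moment ?d) = ennreal (?v * half_moment (?d + 2))"
    unfolding tail .
  have "?K = ?K + ennreal (?v * half_moment ?d) - ennreal (?v * half_moment ?d)"
    by (rule ennreal_add_diff_cancel_right[symmetric]) simp
  also have "\<dots> = ennreal (?v * half_moment (?d + 2)) - ennreal (?v * half_moment ?d)"
    unfolding sum ..
  also have "\<dots> = ennreal (?v * half_moment (?d + 2) - ?v * half_moment ?d)"
    by (rule ennreal_minus) (intro mult_nonneg_nonneg half_moment_nonneg unit_ball_vol_nonneg of_nat_0_le_iff)
  also have "?v * half_moment (?d + 2) - ?v * half_moment ?d = real ?d * ?v * half_moment ?d"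
    unfolding half_moment_Suc_Suc by (simp add: algebra_simps)
  finally show ?thesis .
qed

section \<open>Orthonormal frames and the decrease of one step\<close>

lemma stiefel_columns:
  assumes "X \<in> stiefel"
  shows "column i X \<bullet> column j X = (if i = j then 1 else 0)"
proof -
  have "(transpose X ** X) $ i $ j = mat 1 $ i $ j" using assms by (simp add: stiefel_def)
  then show ?thesis by (simp add: matrix_mult_transpose_dot_column mat_def)
qed

text \<open>
  The columns of \<open>X\<close> are completed to an orthonormal basis, the columns of \<open>Q\<close>; the map \<open>\<iota>\<close> records
  where the original columns are placed.
\<close>
lemma stiefel_extend_orthogonal:
  fixes X :: "real ^ 'p ^ 'd"
  assumes X: "X \<in> stiefel"
  obtains Q :: "real ^ 'd ^ 'd" and \<iota> :: "'p \<Rightarrow> 'd"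
  where "orthogonal_matrix Q" "inj \<iota>" "\<And>i. Q *v axis (\<iota> i) 1 = column i X"
proof -
  let ?S = "range (\<lambda>i. column i X)"
  have norm_S: "norm (column i X) = 1" for i
    using stiefel_columns[OF X, of i i] by (simp add: norm_eq_1)
  have orth: "pairwise orthogonal ?S"
    unfolding pairwise_def orthogonal_def using stiefel_columns[OF X] by (auto split: if_splits)
  obtain U where U: "U \<inter> insert 0 ?S = {}" "pairwise orthogonal (?S \<union> U)" "span (?S \<union> U) = span (?S \<union> UNIV)"
    using orthogonal_extension_strong[OF orth] by blast
  have "column i X \<noteq> 0" for i using norm_S[of i] by auto
  then have zero: "0 \<notin> ?S \<union> U" using U(1) by (auto simp: image_iff dest: sym)
  then have indep: "independent (?S \<union> U)" using U(2) pairwise_orthogonal_independent by blast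
  have "card (?S \<union> U) = DIM(real ^ 'd)"
  proof -
    have "card (?S \<union> U) = dim (?S \<union> U)" by (rule dim_eq_card_independent[OF indep, symmetric])
    also have "\<dots> = dim (span (?S \<union> U))" by (rule dim_span[symmetric])
    finally show ?thesis unfolding U(3) by simp
  qed
  then obtain h where h: "bij_betw h (UNIV :: 'd set) (?S \<union> U)"
    using finite_same_card_bij[of "UNIV :: 'd set" "?S \<union> U"] independent_imp_finite[OF indep] by auto
  have h_mem: "h j \<in> ?S \<union> U" for j using h by (auto simp: bij_betw_def)
  have nz: "h j \<noteq> 0" for j using h_mem[of j] zero by auto
  \<comment> \<open>The vectors from the extension are not normalised, whereas the columns of \<open>X\<close> already are.\<close>
  let ?q = "\<lambda>j. h j /\<^sub>R norm (h j)"
  let ?Q = "(\<chi> i j. ?q j $ i) :: real ^ 'd ^ 'd"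
  define \<iota> where "\<iota> i = inv_into UNIV h (column i X)" for i
  have h_\<iota>: "h (\<iota> i) = column i X" for i
    unfolding \<iota>_def using h by (intro f_inv_into_f) (auto simp: bij_betw_def)
  have column_Q: "column j ?Q = ?q j" for j by (simp add: column_def vec_eq_iff)
  show ?thesis
  proof
    have "orthogonal (h i) (h j)" if "i \<noteq> j" for i j
    proof -
      have "h i \<noteq> h j" using that h by (auto simp: bij_betw_def inj_on_eq_iff)
      with U(2) h_mem[of i] h_mem[of j] show ?thesis unfolding pairwise_def by blast
    qed
    then show "orthogonal_matrix ?Q"
      unfolding orthogonal_matrix_orthonormal_columns column_Q using nz by (auto simp: orthogonal_def)
    show "inj \<iota>"
    proof (rule injI)
      fix i j assume "\<iota> i = \<iota> j"
      then have "column i X = column j X" using h_\<iota>[of i] h_\<iota>[of j] by simp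
      then show "i = j" using stiefel_columns[OF X, of i j] stiefel_columns[OF X, of i i] by (auto split: if_splits)
    qed
    show "?Q *v axis (\<iota> i) 1 = column i X" for i
      unfolding matrix_vector_mult_basis column_Q by (simp add: h_\<iota> norm_S)
  qed
qed

lemma f_lin_move: "f_lin g (move x B u) = f_lin g x + (\<Sum>i\<in>UNIV. u $ i * (column i B \<bullet> g))"
  by (simp add: f_lin_def move_def inner_add_right inner_sum_right inner_commute)

text \<open>
  The decrease does not depend on how ties between minimizers are broken. The value is nonnegative,
  so that the null step is optimal only if all directional derivatives vanish.
\<close>
lemma ds_minimizer_decrease:
  fixes z :: "real ^ 'p"
  assumes "ds_minimizer g x B z"
  shows "f_lin g x - f_lin g (move x B z) = Max (range (\<lambda>i. \<bar>column i B \<bullet> g\<bar>))"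
proof -
  let ?v = "\<lambda>u::real ^ 'p. \<Sum>i\<in>UNIV. u $ i * (column i B \<bullet> g)"
  have v_axis: "?v (axis i 1) = column i B \<bullet> g" "?v (- axis i 1) = - (column i B \<bullet> g)" for i
    by (simp_all add: axis_def if_distrib[where f = "\<lambda>t. t * _"] sum_negf cong: if_cong)
  have min: "?v z \<le> ?v u" if "u \<in> poll_set" for u
    using assms that by (auto simp: ds_minimizer_def is_arg_min_def f_lin_move not_less)
  have le_Max: "\<bar>column i B \<bullet> g\<bar> \<le> Max (range (\<lambda>i. \<bar>column i B \<bullet> g\<bar>))" for i
    by (rule Max_ge) auto
  have "z \<in> poll_set" using assms by (simp add: ds_minimizer_def is_arg_min_def)
  then consider i where "z = axis i 1" | i where "z = - axis i 1" | "z = 0"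
    unfolding poll_set_def by blast
  then have "- ?v z \<le> Max (range (\<lambda>i. \<bar>column i B \<bullet> g\<bar>))"
  proof cases
    case 1
    show ?thesis unfolding 1 v_axis using le_Max[of i] by linarith
  next
    case 2
    show ?thesis unfolding 2 v_axis using le_Max[of i] by linarith
  next
    case 3
    then have "?v z = 0" by simp
    then show ?thesis using le_Max[of undefined] by linarith
  qed
  moreover have "Max (range (\<lambda>i. \<bar>column i B \<bullet> g\<bar>)) \<le> - ?v z"
  proof (subst Max_le_iff)
    have "\<bar>column i B \<bullet> g\<bar> \<le> - ?v z" for i
    proof -
      have "axis i 1 \<in> poll_set" "- axis i 1 \<in> poll_set" unfolding poll_set_def by blast+
      then have "?v z \<le> ?v (axis i 1)" "?v z \<le> ?v (- axis i 1)" by (blast intro: min)+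
      then show ?thesis unfolding v_axis by linarith
    qed
    then show "\<forall>a\<in>range (\<lambda>i. \<bar>column i B \<bullet> g\<bar>). a \<le> - ?v z" by blast
  qed auto
  ultimately show ?thesis by (simp add: f_lin_move)
qed

text \<open>
  Independence as a product law, for random variables with values in two different spaces.
\<close>
lemma distr_pair_of_indep_set:
  assumes "prob_space M" and [measurable]: "X \<in> measurable M S" "Y \<in> measurable M T"
    and indep: "prob_space.indep_set M {X -` A \<inter> space M | A. A \<in> sets S} {Y -` A \<inter> space M | A. A \<in> sets T}"
  shows "distr M (S \<Otimes>\<^sub>M T) (\<lambda>\<omega>. (X \<omega>, Y \<omega>)) = distr M S X \<Otimes>\<^sub>M distr M T Y"
proof -
  interpret prob_space M by fact
  interpret X: prob_space "distr M S X" by (rule prob_space_distr) fact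
  interpret Y: prob_space "distr M T Y" by (rule prob_space_distr) fact
  show ?thesis
  proof (rule pair_measure_eqI[symmetric])
    fix A B assume "A \<in> sets (distr M S X)" "B \<in> sets (distr M T Y)"
    then have [measurable]: "A \<in> sets S" "B \<in> sets T" by simp_all
    have "prob ((X -` A \<inter> space M) \<inter> (Y -` B \<inter> space M)) = prob (X -` A \<inter> space M) * prob (Y -` B \<inter> space M)"
      by (rule indep_setD[OF indep]) auto
    moreover have "(\<lambda>\<omega>. (X \<omega>, Y \<omega>)) -` (A \<times> B) \<inter> space M = (X -` A \<inter> space M) \<inter> (Y -` B \<inter> space M)"
      by auto
    ultimately show "emeasure (distr M S X) A * emeasure (distr M T Y) B
        = emeasure (distr M (S \<Otimes>\<^sub>M T) (\<lambda>\<omega>. (X \<omega>, Y \<omega>))) (A \<times> B)"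
      by (simp add: emeasure_distr emeasure_eq_measure ennreal_mult')
  qed (auto intro: X.sigma_finite_measure_axioms Y.sigma_finite_measure_axioms)
qed

section \<open>The uniform distribution on the sphere\<close>

text \<open>
  The integral of \<open>norm x\<close> against the Gaussian weight, see \<open>nn_integral_gaussian_norm\<close>. The
  argument only fixes the space.
\<close>
definition gaussian_norm_moment :: "'a::euclidean_space itself \<Rightarrow> real" where
  "gaussian_norm_moment _ = real DIM('a) * unit_ball_vol DIM('a) * half_moment DIM('a)"

lemma gaussian_norm_moment_pos: "0 < gaussian_norm_moment TYPE('a::euclidean_space)"
  unfolding gaussian_norm_moment_def by (intro mult_pos_pos half_moment_pos unit_ball_vol_pos) auto

text \<open>
  The law of \<open>x / norm x\<close> when \<open>x\<close> has density proportional to \<open>norm x * exp (- (norm x)\<^sup>2/2)\<close>. The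
  additional factor \<open>norm x\<close> cancels against the scaling of positively homogeneous functions, and it
  gives no weight to the origin, where \<open>x / norm x\<close> has the default value \<open>0\<close>.
\<close>
definition sphere_law :: "'a::euclidean_space measure" where
  "sphere_law = distr (density lborel (\<lambda>x. ennreal (norm x / gaussian_norm_moment TYPE('a)) * gaussian_weight x))
     borel (\<lambda>x. x /\<^sub>R norm x)"

lemma nn_integral_sphere_law:
  fixes F :: "'a::euclidean_space \<Rightarrow> ennreal"
  assumes [measurable]: "F \<in> borel_measurable borel"
  shows "(\<integral>\<^sup>+x. F x \<partial>sphere_law)
    = (\<integral>\<^sup>+x. ennreal (norm x / gaussian_norm_moment TYPE('a)) * gaussian_weight x * F (x /\<^sub>R norm x) \<partial>lborel)"
  unfolding sphere_law_def by (subst nn_integral_distr, measurable, subst nn_integral_density, measurable)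

lemma sets_sphere_law: "sets sphere_law = sets borel"
  by (simp add: sphere_law_def)

lemma prob_space_sphere_law: "prob_space (sphere_law :: 'a::euclidean_space measure)"
proof
  let ?K = "gaussian_norm_moment TYPE('a)"
  have "emeasure sphere_law (space (sphere_law :: 'a measure)) = (\<integral>\<^sup>+x. 1 \<partial>(sphere_law :: 'a measure))" by simp
  also have "\<dots> = (\<integral>\<^sup>+x. ennreal (1 / ?K) * (ennreal (norm x) * gaussian_weight (x::'a)) \<partial>lborel)"
    using gaussian_norm_moment_pos[where 'a = 'a]
    by (subst nn_integral_sphere_law) (auto intro!: nn_integral_cong simp: ennreal_mult[symmetric])
  also have "\<dots> = ennreal (1 / ?K) * ennreal ?K"
    by (subst nn_integral_cmult, measurable) (simp only: nn_integral_gaussian_norm gaussian_norm_moment_def)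
  also have "\<dots> = 1"
    using gaussian_norm_moment_pos[where 'a = 'a] by (simp add: ennreal_mult''[symmetric])
  finally show "emeasure sphere_law (space (sphere_law :: 'a measure)) = 1" .
qed

lemma AE_sphere_law: "AE x in sphere_law. x \<in> sphere (0::'a::euclidean_space) 1"
  unfolding sphere_law_def
proof (subst AE_distr_iff)
  show "AE x in density lborel (\<lambda>x. ennreal (norm x / gaussian_norm_moment TYPE('a)) * gaussian_weight x).
      x /\<^sub>R norm x \<in> sphere (0::'a) 1"
  proof (subst AE_density)
    show "AE x in lborel. 0 < ennreal (norm x / gaussian_norm_moment TYPE('a)) * gaussian_weight x \<longrightarrow>
        x /\<^sub>R norm x \<in> sphere (0::'a) 1"
    proof (intro AE_I2 impI)
      fix x :: 'a assume "0 < ennreal (norm x / gaussian_norm_moment TYPE('a)) * gaussian_weight x"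
      then have "x \<noteq> 0" by (cases "x = 0") simp_all
      then show "x /\<^sub>R norm x \<in> sphere (0::'a) 1" by simp
    qed
  qed measurable
qed auto

lemma sphere_law_rotation_invariant:
  fixes f :: "'a::euclidean_space \<Rightarrow> 'a"
  assumes f: "orthogonal_transformation f"
  shows "distr sphere_law borel f = sphere_law"
proof (rule measure_eqI)
  have lin: "linear f" using f by (rule orthogonal_transformation_linear)
  have [measurable]: "f \<in> borel_measurable borel"
    using lin by (intro borel_measurable_continuous_onI linear_continuous_on linear_conv_bounded_linear[THEN iffD1])
  fix S assume "S \<in> sets (distr sphere_law borel f)"
  then have [measurable]: "S \<in> sets borel" by simp
  let ?w = "\<lambda>x::'a. ennreal (norm x / gaussian_norm_moment TYPE('a)) * gaussian_weight x"
  have "emeasure (distr sphere_law borel f) S = (\<integral>\<^sup>+x. indicator S x \<partial>distr sphere_law borel f)"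
    by (rule nn_integral_indicator[symmetric]) simp
  also have "\<dots> = (\<integral>\<^sup>+x. indicator S (f x) \<partial>sphere_law)"
    by (rule nn_integral_distr) (simp_all add: measurable_cong_sets[OF sets_sphere_law refl])
  also have "\<dots> = (\<integral>\<^sup>+x. ?w x * indicator S (f (x /\<^sub>R norm x)) \<partial>lborel)"
    by (rule nn_integral_sphere_law) measurable
  also have "\<dots> = (\<integral>\<^sup>+x. ?w (f x) * indicator S (f x /\<^sub>R norm (f x)) \<partial>lborel)"
    by (simp only: orthogonal_transformation_norm[OF f] linear_scale[OF lin])
  also have "\<dots> = (\<integral>\<^sup>+x. ?w x * indicator S (x /\<^sub>R norm x) \<partial>distr lborel borel f)"
    by (rule nn_integral_distr[symmetric]) measurable
  also have "\<dots> = (\<integral>\<^sup>+x. indicator S x \<partial>sphere_law)"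
    unfolding distr_lborel_orthogonal[OF f] by (rule nn_integral_sphere_law[symmetric]) measurable
  also have "\<dots> = emeasure sphere_law S"
    by (rule nn_integral_indicator) (simp add: sets_sphere_law)
  finally show "emeasure (distr sphere_law borel f) S = emeasure sphere_law S" .
qed (simp add: sets_sphere_law)

lemma uniform_on_sphere_eq_sphere_law:
  fixes N :: "(real ^ 'd) measure"
  assumes "uniform_on_sphere N"
  shows "N = sphere_law"
proof (rule rotation_invariant_sphere_unique)
  show prob: "prob_space N" using assms by (simp add: uniform_on_sphere_def)
  interpret prob_space N by (rule prob)
  show "sets N = sets borel" using assms by (simp add: uniform_on_sphere_def)
  then show "AE x in N. x \<in> sphere 0 1"
    using assms by (subst AE_in_set_eq_1) (auto simp: uniform_on_sphere_def measure_def)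
  fix f :: "real ^ 'd \<Rightarrow> real ^ 'd" assume f: "orthogonal_transformation f"
  then have "orthogonal_matrix (matrix f)" and f_eq: "(\<lambda>x. matrix f *v x) = f"
    by (auto simp: orthogonal_transformation_matrix matrix_works)
  then have "distr N borel (\<lambda>x. matrix f *v x) = N"
    using assms unfolding uniform_on_sphere_def by blast
  then show "distr N borel f = N" unfolding f_eq .
qed (fact prob_space_sphere_law sets_sphere_law AE_sphere_law | erule sphere_law_rotation_invariant)+

text \<open>
  Since the maximum is positively homogeneous, its mean on the sphere is the quotient of its Gaussian
  integral by that of the norm.
\<close>
lemma nn_integral_sphere_law_Max:
  fixes J :: "'a::euclidean_space set"
  assumes J: "J \<subseteq> Basis" "J \<noteq> {}"
  shows "(\<integral>\<^sup>+x. ennreal (Max ((\<lambda>b. \<bar>x \<bullet> b\<bar>) ` J)) \<partial>sphere_law)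
    = ennreal (sqrt (2 * pi) ^ (DIM('a) - card J) * (real (card J) * 2 ^ card J * half_moment (card J))
        * ds_integral (card J) / gaussian_norm_moment TYPE('a))"
proof -
  let ?K = "gaussian_norm_moment TYPE('a)"
  let ?F = "\<lambda>x::'a. Max ((\<lambda>b. \<bar>x \<bullet> b\<bar>) ` J)"
  have fin: "finite J" using J(1) finite_Basis by (rule finite_subset)
  have [measurable]: "?F \<in> borel_measurable borel"
    using fin J(2) by (intro borel_measurable_Max) auto
  have nonneg: "0 \<le> ?F x" for x
  proof -
    obtain b where "b \<in> J" using J(2) by blast
    then have "\<bar>x \<bullet> b\<bar> \<le> ?F x" using fin by (intro Max_ge) auto
    then show ?thesis by linarith
  qed
  have hom: "norm x * ?F (x /\<^sub>R norm x) = ?F x" for x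
  proof (cases "x = 0")
    case True
    then have "(\<lambda>b. \<bar>x \<bullet> b\<bar>) ` J = {0}" using J(2) by auto
    then show ?thesis using True by simp
  next
    case False
    have "norm x * ?F (x /\<^sub>R norm x) = Max ((*) (norm x) ` (\<lambda>b. \<bar>(x /\<^sub>R norm x) \<bullet> b\<bar>) ` J)"
      using fin J(2) by (intro mono_Max_commute) (auto intro!: monoI mult_left_mono)
    also have "(*) (norm x) ` (\<lambda>b. \<bar>(x /\<^sub>R norm x) \<bullet> b\<bar>) ` J = (\<lambda>b. \<bar>x \<bullet> b\<bar>) ` J"
      using False by (auto simp: image_image abs_mult intro!: image_cong)
    finally show ?thesis .
  qed
  have "(\<integral>\<^sup>+x. ennreal (?F x) \<partial>sphere_law)
      = (\<integral>\<^sup>+x. ennreal (norm x / ?K) * gaussian_weight x * ennreal (?F (x /\<^sub>R norm x)) \<partial>lborel)"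
    by (rule nn_integral_sphere_law) measurable
  also have "\<dots> = (\<integral>\<^sup>+x. ennreal (1 / ?K) * (ennreal (?F x) * gaussian_weight x) \<partial>lborel)"
  proof (rule nn_integral_cong)
    fix x :: 'a
    have "ennreal (norm x / ?K) * ennreal (?F (x /\<^sub>R norm x)) = ennreal (norm x / ?K * ?F (x /\<^sub>R norm x))"
      using gaussian_norm_moment_pos[where 'a = 'a] by (intro ennreal_mult[symmetric] nonneg) simp
    also have "norm x / ?K * ?F (x /\<^sub>R norm x) = 1 / ?K * ?F x"
      unfolding hom[of x, symmetric] by (simp only: times_divide_eq_left mult_1_left)
    also have "ennreal \<dots> = ennreal (1 / ?K) * ennreal (?F x)"
      using gaussian_norm_moment_pos[where 'a = 'a] by (intro ennreal_mult nonneg) simp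
    finally have e: "ennreal (norm x / ?K) * ennreal (?F (x /\<^sub>R norm x)) = ennreal (1 / ?K) * ennreal (?F x)" .
    show "ennreal (norm x / ?K) * gaussian_weight x * ennreal (?F (x /\<^sub>R norm x))
        = ennreal (1 / ?K) * (ennreal (?F x) * gaussian_weight x)"
      using arg_cong[OF e, of "\<lambda>t. t * gaussian_weight x"] by (simp only: mult_ac)
  qed
  also have "\<dots> = ennreal (1 / ?K) * (\<integral>\<^sup>+x. ennreal (?F x) * gaussian_weight x \<partial>lborel)"
    by (rule nn_integral_cmult) measurable
  also have "\<dots> = ennreal (1 / ?K) * ennreal (sqrt (2 * pi) ^ (DIM('a) - card J)
      * (real (card J) * 2 ^ card J * half_moment (card J)) * ds_integral (card J))"
    by (simp only: nn_integral_gaussian_Max[OF J])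
  also have "\<dots> = ennreal (1 / ?K * (sqrt (2 * pi) ^ (DIM('a) - card J)
      * (real (card J) * 2 ^ card J * half_moment (card J)) * ds_integral (card J)))"
    using gaussian_norm_moment_pos[where 'a = 'a] by (intro ennreal_mult'[symmetric]) simp
  finally show ?thesis by simp
qed

section \<open>The expected decrease\<close>

lemma half_moment_eq: "half_moment k = sqrt 2 ^ k / sqrt 2 * Gamma ((real k + 1) / 2)"
proof -
  have "(real k - 1) / 2 = real k / 2 - 1 / 2" by (simp add: field_simps)
  then have "2 powr ((real k - 1) / 2) = 2 powr (real k / 2) / 2 powr (1 / 2)"
    by (simp only: powr_diff)
  also have "2 powr (real k / 2) = ((2::real) powr (1 / 2)) ^ k"
    using powr_powr[of "2::real" "1/2" "real k"] by (simp add: powr_realpow)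
  finally show ?thesis by (simp add: half_moment_def powr_half_sqrt)
qed

lemma gaussian_norm_moment_eq:
  "gaussian_norm_moment TYPE('a::euclidean_space)
    = 2 * sqrt pi ^ DIM('a) * half_moment DIM('a) / Gamma (real DIM('a) / 2)"
proof -
  let ?d = "DIM('a)"
  have "real ?d / 2 \<notin> \<int>\<^sub>\<le>\<^sub>0" using DIM_positive[where 'a = 'a] by (auto dest: nonpos_Ints_nonpos)
  then have "Gamma (real ?d / 2 + 1) = real ?d / 2 * Gamma (real ?d / 2)" by (rule Gamma_plus1)
  moreover have "pi powr (real ?d / 2) = sqrt pi ^ ?d"
    by (simp add: powr_half_sqrt[symmetric] powr_power)
  moreover have "D * (P / (D / 2 * G)) * m = 2 * P * m / G" if "D \<noteq> 0" for D P G m :: real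
    using that by (simp add: field_simps)
  ultimately show ?thesis
    unfolding gaussian_norm_moment_def unit_ball_vol_def by (simp only:) simp
qed

text \<open>
  The powers of \<open>sqrt 2\<close> coming from the half line moments and from \<open>sqrt (2 * pi)\<close> cancel.
\<close>
lemma ds_constant:
  assumes "p \<le> DIM('a::euclidean_space)"
  shows "sqrt (2 * pi) ^ (DIM('a) - p) * (real p * 2 ^ p * half_moment p) * I / gaussian_norm_moment TYPE('a)
    = real p / 2 * (2 ^ p / sqrt pi ^ p)
       * (Gamma (real DIM('a) / 2) * Gamma (real p / 2 + 1 / 2) / Gamma (real DIM('a) / 2 + 1 / 2)) * I"
proof -
  let ?d = "DIM('a)"
  have pos: "0 < Gamma (real ?d / 2)" "0 < Gamma (real ?d / 2 + 1 / 2)"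
    by (intro Gamma_real_pos; simp add: add_pos_pos)+
  have e: "(real k + 1) / 2 = real k / 2 + 1 / 2" for k by (simp add: field_simps)
  have pow: "sqrt (2 * pi) ^ (?d - p) = sqrt 2 ^ ?d * sqrt pi ^ ?d / (sqrt 2 ^ p * sqrt pi ^ p)"
    unfolding real_sqrt_mult power_mult_distrib using assms by (simp add: power_diff)
  have "(s * t / (u * v)) * (p * c * (u / r * Gp)) * I / (2 * t * (s / r * Gd') / Gd)
      = p / 2 * (c / v) * (Gd * Gp / Gd') * I"
    if "s \<noteq> 0" "t \<noteq> 0" "u \<noteq> 0" "v \<noteq> 0" "r \<noteq> 0" "Gd \<noteq> 0" "Gd' \<noteq> 0" for s t u v p c r Gp Gd Gd' :: real
    using that by (simp add: field_simps)
  note cancel = this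
  show ?thesis
    unfolding pow half_moment_eq gaussian_norm_moment_eq e
    by (rule cancel) (fact pos[THEN less_imp_neq, symmetric] | simp)+
qed

text \<open>
  The conditional expectation of the decrease given \<open>B\<close>. Rotating by \<open>Q\<close> replaces the columns of \<open>B\<close> by
  coordinate vectors, so it does not depend on \<open>B\<close>.
\<close>
lemma nn_integral_uniform_sphere_stiefel:
  fixes N :: "(real ^ 'd) measure" and B :: "real ^ 'p ^ 'd"
  assumes N: "uniform_on_sphere N" and B: "B \<in> stiefel" and le: "CARD('p) \<le> CARD('d)"
  shows "(\<integral>\<^sup>+x. ennreal (Max (range (\<lambda>i. \<bar>column i B \<bullet> x\<bar>))) \<partial>N)
    = ennreal (real CARD('p) / 2 * (2 ^ CARD('p) / sqrt pi ^ CARD('p))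
       * (Gamma (real CARD('d) / 2) * Gamma (real CARD('p) / 2 + 1 / 2) / Gamma (real CARD('d) / 2 + 1 / 2))
       * ds_integral CARD('p))"
proof -
  obtain Q :: "real ^ 'd ^ 'd" and \<iota> :: "'p \<Rightarrow> 'd"
    where Q: "orthogonal_matrix Q" "inj \<iota>" "\<And>i. Q *v axis (\<iota> i) 1 = column i B"
    using stiefel_extend_orthogonal[OF B] by blast
  let ?F = "\<lambda>x. Max (range (\<lambda>i. \<bar>column i B \<bullet> x\<bar>))"
  define J where "J = range (\<lambda>i. axis (\<iota> i) (1::real))"
  have J: "J \<subseteq> Basis" "J \<noteq> {}" by (auto simp: J_def Basis_vec_def)
  have "inj (\<lambda>i. axis (\<iota> i) (1::real))"
    using Q(2) by (auto simp: inj_def axis_eq_axis)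
  then have card_J: "card J = CARD('p)" unfolding J_def by (simp add: card_image)
  have sets_N: "sets N = sets borel" and inv: "distr N borel (\<lambda>x. Q *v x) = N"
    using N Q(1) by (auto simp: uniform_on_sphere_def)
  have [measurable]: "?F \<in> borel_measurable borel" by (intro borel_measurable_Max) auto
  have [measurable]: "(\<lambda>x. Q *v x) \<in> borel_measurable borel"
    by (intro borel_measurable_continuous_onI linear_continuous_on linear_conv_bounded_linear[THEN iffD1] matrix_vector_mul_linear)
  have inner_Q: "(Q *v x) \<bullet> (Q *v y) = x \<bullet> y" for x y
    using Q(1) orthogonal_transformation_matrix[of "(*v) Q"] by (simp add: orthogonal_transformation_def)
  have "(\<integral>\<^sup>+x. ennreal (?F x) \<partial>N) = (\<integral>\<^sup>+x. ennreal (?F x) \<partial>distr N borel (\<lambda>x. Q *v x))"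
    unfolding inv ..
  also have "\<dots> = (\<integral>\<^sup>+x. ennreal (?F (Q *v x)) \<partial>N)"
    by (rule nn_integral_distr) (simp_all add: measurable_cong_sets[OF sets_N refl])
  also have "\<dots> = (\<integral>\<^sup>+x. ennreal (Max ((\<lambda>b. \<bar>x \<bullet> b\<bar>) ` J)) \<partial>N)"
    unfolding Q(3)[symmetric] inner_Q J_def image_image by (simp only: inner_commute)
  also have "\<dots> = ennreal (sqrt (2 * pi) ^ (DIM(real ^ 'd) - card J) * (real (card J) * 2 ^ card J * half_moment (card J))
        * ds_integral (card J) / gaussian_norm_moment TYPE(real ^ 'd))"
    unfolding uniform_on_sphere_eq_sphere_law[OF N] by (rule nn_integral_sphere_law_Max[OF J])
  finally show ?thesis
    using ds_constant[of "CARD('p)", where 'a = "real ^ 'd"] le by (simp add: card_J)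
qed

lemma ds_integral_nonneg: "0 \<le> ds_integral p"
proof (cases "p = 1")
  case False
  have "0 \<le> indicator (ds_region p) \<phi> *\<^sub>R (\<Prod>i=1..p-1. sin (\<phi> i) ^ i)" for \<phi>
  proof (cases "\<phi> \<in> ds_region p \<and> 1 < p")
    case True
    then have "0 \<le> (\<Prod>i=1..p-1. sin (\<phi> i) ^ i)"
      using sin_pos_of_angles[of "p-1" \<phi>] unfolding ds_region_eq[OF conjunct2[OF True]]
      by (intro prod_nonneg) (auto intro!: zero_le_power less_imp_le)
    then show ?thesis by simp
  next
    case F: False
    then show ?thesis using \<open>p \<noteq> 1\<close> by (cases "p = 0") auto
  qed
  then show ?thesis
    unfolding ds_integral_def set_lebesgue_integral_def if_not_P[OF False] by (intro Bochner_Integration.integral_nonneg) simp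
qed (simp add: ds_integral_def)

theorem theorem3p2:
  fixes M :: "'a measure"
    and g :: "'a \<Rightarrow> real ^ 'd"
    and B :: "'a \<Rightarrow> real ^ 'p ^ 'd"
    and z :: "'a \<Rightarrow> real ^ 'p"
    and xk :: "real ^ 'd"
    and p d :: nat
  assumes "CARD('d) = d" and "CARD('p) = p"
    and "d > 1" and "1 \<le> p" and "p \<le> d"
    and "prob_space M"
    and "g \<in> borel_measurable M" and "uniform_on_sphere (distr M borel g)"
    and "B \<in> borel_measurable M" and "uniform_on_stiefel (distr M borel B)"
    and "prob_space.indep_set M {g -` A \<inter> space M | A. A \<in> sets borel}
                                {B -` A \<inter> space M | A. A \<in> sets borel}"
    and "\<And>\<omega>. \<omega> \<in> space M \<Longrightarrow> ds_minimizer (g \<omega>) xk (B \<omega>) (z \<omega>)"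
  shows "prob_space.expectation M
           (\<lambda>\<omega>. f_lin (g \<omega>) xk - f_lin (g \<omega>) (move xk (B \<omega>) (z \<omega>)))
         = real p / 2 * (2 ^ p / sqrt pi ^ p)
           * (Gamma (real d / 2) * Gamma (real p / 2 + 1 / 2) / Gamma (real d / 2 + 1 / 2))
           * ds_integral p"
    (is "_ = ?c")
proof -
  interpret prob_space M by fact
  note [measurable] = assms(7,9)
  let ?N = "distr M borel g" and ?R = "distr M borel B"
  let ?h = "\<lambda>(g :: real ^ 'd) (B :: real ^ 'p ^ 'd). Max (range (\<lambda>i. \<bar>column i B \<bullet> g\<bar>)) :: real"
  interpret N: prob_space ?N by (rule prob_space_distr) fact
  interpret R: prob_space ?R by (rule prob_space_distr) fact
  interpret pair_sigma_finite ?N ?R ..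
  have column_meas: "(column i :: real ^ 'p ^ 'd \<Rightarrow> real ^ 'd) \<in> borel_measurable borel" for i
    unfolding column_def by (intro borel_measurable_continuous_onI continuous_intros)
  have h[measurable]: "(\<lambda>(g, B). ?h g B) \<in> borel_measurable (borel \<Otimes>\<^sub>M borel)"
    unfolding case_prod_beta
    by (intro borel_measurable_Max borel_measurable_abs borel_measurable_inner
          measurable_compose[OF measurable_snd column_meas] measurable_fst) auto
  have h_nonneg: "0 \<le> ?h g B" for g :: "real ^ 'd" and B :: "real ^ 'p ^ 'd"
  proof -
    have "\<bar>column undefined B \<bullet> g\<bar> \<le> ?h g B" by (rule Max_ge) auto
    then show ?thesis by linarith
  qed
  have c_nonneg: "0 \<le> ?c"
    by (intro mult_nonneg_nonneg divide_nonneg_nonneg ds_integral_nonneg Gamma_real_nonneg)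
      (use assms(3) in auto)
  have inner: "(\<integral>\<^sup>+x. ennreal (?h x X) \<partial>?N) = ennreal ?c" if "X \<in> stiefel" for X :: "real ^ 'p ^ 'd"
    using nn_integral_uniform_sphere_stiefel[OF assms(8) that] assms(1,2,5) by simp
  \<comment> \<open>A non-measurable set would have \<open>emeasure\<close> \<open>0\<close>, not \<open>1\<close>.\<close>
  have stiefel_sets: "stiefel \<in> sets (?R :: (real ^ 'p ^ 'd) measure)"
    using assms(10) emeasure_notin_sets[of stiefel ?R] by (auto simp: uniform_on_stiefel_def)
  have AE_stiefel: "AE X in ?R. X \<in> stiefel"
    using assms(10) by (subst R.AE_in_set_eq_1[OF stiefel_sets]) (simp add: uniform_on_stiefel_def measure_def)
  have "expectation (\<lambda>\<omega>. f_lin (g \<omega>) xk - f_lin (g \<omega>) (move xk (B \<omega>) (z \<omega>)))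
      = expectation (\<lambda>\<omega>. ?h (g \<omega>) (B \<omega>))"
    by (intro Bochner_Integration.integral_cong refl ds_minimizer_decrease assms)
  also have "\<dots> = enn2real (\<integral>\<^sup>+\<omega>. ennreal (?h (g \<omega>) (B \<omega>)) \<partial>M)"
    using h_nonneg measurable_compose[OF measurable_Pair[OF assms(7,9)] h]
    by (intro integral_eq_nn_integral) auto
  also have "(\<integral>\<^sup>+\<omega>. ennreal (?h (g \<omega>) (B \<omega>)) \<partial>M)
      = (\<integral>\<^sup>+y. ennreal (?h (fst y) (snd y)) \<partial>distr M (borel \<Otimes>\<^sub>M borel) (\<lambda>\<omega>. (g \<omega>, B \<omega>)))"
    using measurable_compose[OF h measurable_ennreal] unfolding case_prod_beta
    by (subst nn_integral_distr) auto
  also have "\<dots> = (\<integral>\<^sup>+y. ennreal (?h (fst y) (snd y)) \<partial>(?N \<Otimes>\<^sub>M ?R))"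
    by (simp only: distr_pair_of_indep_set[OF assms(6,7,9,11)])
  \<comment> \<open>Condition on \<open>B\<close>: the inner integral is over the direction \<open>g\<close> alone.\<close>
  also have "\<dots> = (\<integral>\<^sup>+X. \<integral>\<^sup>+x. ennreal (?h x X) \<partial>?N \<partial>?R)"
    using measurable_compose[OF h measurable_ennreal] unfolding case_prod_beta
    by (subst nn_integral_snd[symmetric]) (simp_all add: measurable_cong_sets[OF sets_pair_measure_cong[OF sets_distr sets_distr] refl])
  also have "\<dots> = (\<integral>\<^sup>+X. ennreal ?c \<partial>?R)"
    using AE_stiefel by (intro nn_integral_cong_AE) (elim eventually_mono, rule inner)
  also have "\<dots> = ennreal ?c" using R.emeasure_space_1 by simp
  finally show ?thesis using c_nonneg by simp
qed

end
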